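(* Let $d\in\mathbb{N}$ with $d\geq 2$ and let $(e_{n})_{n\in\mathbb{N}}$ be a sequence of real numbers with $e_{n}\geq 1$. Then there exists a sequence $(c_{n})$ of positive real numbers satisfying $$|c_{n}-e_{n}|\leq \frac{2^{d+8}}{(\log n)^{1/d}}\quad\text{for all } n\geq 2,$$ such that the following holds. For each $n\in\mathbb{N}$ define $F_{n}\colon \binom{\mathbb{Z}^{d}}{n^{d}}\to(0,\infty)$ by $$F_{n}(S)=\min\{\operatorname{Lip}(f)\colon f\colon S\to\{1,\ldots,n\}^{d}\text{ surjective}\}.$$ Consider the probability space $\mathcal{G}_{(c_{n})}=\prod_{n=1}^{\infty}\binom{\{1,\ldots,\lfloor c_{n} n\rfloor\}^{d}}{n^{d}}$ equipped with the product of the uniform probability measures on its finite factors. Then a random sequence $(S_{n})\in\mathcal{G}_{(c_{n})}$ satisfies $$\mathbb{P}\left[\limsup_{n\to\infty}F_{n}(S_{n})(\log n)^{-\alpha/d}<\infty\right]=1$$ for every $\alpha>3$.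
   Context: $\log$ denotes the logarithm to base $2$. For a set $A$ and $k\in\mathbb{N}$, $\binom{A}{k}$ is the set of all $k$-element subsets of $A$. Lipschitz constants are taken with respect to the Euclidean metric. For a finite set $X$ the uniform probability measure is $\mathbb{P}_X(A)=|A|/|X|$ for $A\subseteq X$; on a countable product of finite sets one takes the product of these uniform measures. *)

theory Defs
  imports "HOL-Probability.Probability"
begin

text \<open>Points of Z^d are represented as functions nat => int, extensional
  outside the index set {..<d}.  The cube {1..m}^d:\<close>
definition grid :: "nat \<Rightarrow> int \<Rightarrow> (nat \<Rightarrow> int) set" where
  "grid d m = PiE {..<d} (\<lambda>_. {1..m})"

definition edist :: "nat \<Rightarrow> (nat \<Rightarrow> int) \<Rightarrow> (nat \<Rightarrow> int) \<Rightarrow> real" where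
  "edist d x y = sqrt (\<Sum>i<d. (real_of_int (x i - y i))^2)"

definition lip :: "nat \<Rightarrow> (nat \<Rightarrow> int) set \<Rightarrow> ((nat \<Rightarrow> int) \<Rightarrow> (nat \<Rightarrow> int)) \<Rightarrow> real" where
  "lip d S f = Max (insert 0 {edist d (f x) (f y) / edist d x y | x y. x \<in> S \<and> y \<in> S \<and> x \<noteq> y})"

definition Fmin :: "nat \<Rightarrow> nat \<Rightarrow> (nat \<Rightarrow> int) set \<Rightarrow> real" where
  "Fmin d n S = Min {lip d S f | f. f \<in> S \<rightarrow>\<^sub>E grid d (int n) \<and> f ` S = grid d (int n)}"

definition factor :: "nat \<Rightarrow> (nat \<Rightarrow> real) \<Rightarrow> nat \<Rightarrow> (nat \<Rightarrow> int) set set" where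
  "factor d c n = {S. S \<subseteq> grid d \<lfloor>c n * real n\<rfloor> \<and> card S = n ^ d}"

definition Gspace :: "nat \<Rightarrow> (nat \<Rightarrow> real) \<Rightarrow> (nat \<Rightarrow> (nat \<Rightarrow> int) set) measure" where
  "Gspace d c = PiM {1..} (\<lambda>n. measure_pmf (pmf_of_set (factor d c n)))"

end

theory Submission
  imports Defs "HOL-Real_Asymp.Real_Asymp"
begin

text \<open>
  Round the side of the source cube to \<open>N = 2^k q\<close>, where \<open>n / 2^k\<close> is of order \<open>(log n)^(3/d)\<close>. The
  source then splits into \<open>2^(kd)\<close> leaf cubes of side \<open>q\<close>, each expected to contain about \<open>(log n)^3\<close>
  points of \<open>S\<close>. A Chernoff bound for the hypergeometric distribution and Borel--Cantelli show that almost
  surely, for all large \<open>n\<close>, every dyadic box of scale \<open>h < k\<close> contains its expected number of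
  points up to a relative error \<open>2^(-h) / (4k)\<close>.

  Starting from the uniform distribution on the target cube, refine it to the distribution of \<open>S\<close> among
  the leaves by halving boxes, one coordinate at a time. Each of the \<open>kd\<close> halvings moves mass by at
  most \<open>(n / 2^k) / k\<close> target units, hence all of them together by \<open>O(n / 2^k)\<close>. Only the inequalities
  ``mass of \<open>A\<close> before \<open>\<le>\<close> mass of the \<open>\<rho>\<close>-neighbourhood of \<open>A\<close> after'' are recorded: they
  compose trivially and end in Hall's condition for a bijection of displacement \<open>O(n / 2^k)\<close>. Since
  distinct points of \<open>S\<close> have distance at least \<open>1\<close>, bounded displacement bounds the Lipschitz constant.
\<close>

subsection \<open>Bipartite matchings and transport on a line\<close>

lemma hall_marriage:
  fixes R :: "'a \<Rightarrow> 'b set"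
  assumes "finite I" "\<And>i. i \<in> I \<Longrightarrow> finite (R i)"
    and "\<And>J. J \<subseteq> I \<Longrightarrow> card J \<le> card (\<Union>(R ` J))"
  shows "\<exists>f. inj_on f I \<and> (\<forall>i\<in>I. f i \<in> R i)"
  using assms
proof (induction "card I" arbitrary: I R rule: less_induct)
  case less
  note fin = less.prems(1) and finR = less.prems(2) and hall = less.prems(3)
  consider "I = {}"
    | (tight) J where "J \<subset> I" "J \<noteq> {}" "card (\<Union>(R ` J)) \<le> card J"
    | (loose) i where "i \<in> I" "\<And>J. J \<subset> I \<Longrightarrow> J \<noteq> {} \<Longrightarrow> card J < card (\<Union>(R ` J))"
    by (meson equals0I not_le)
  then show ?case
  proof cases
    case 1
    then show ?thesis by simp
  next
    case tight
    let ?U = "\<Union>(R ` J)"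
    have finJ: "finite J" and J: "J \<subseteq> I" using tight fin by (auto intro: finite_subset)
    have finU: "finite ?U" using finJ J finR by auto
    have "card J < card I" using tight fin by (simp add: psubset_card_mono)
    moreover have "\<And>i. i \<in> J \<Longrightarrow> finite (R i)" using finR J by auto
    moreover have "\<And>K. K \<subseteq> J \<Longrightarrow> card K \<le> card (\<Union>(R ` K))" using hall J by auto
    ultimately obtain f where f: "inj_on f J" "\<forall>i\<in>J. f i \<in> R i"
      using less.hyps[of J R] finJ by blast
    define R' where "R' i = R i - ?U" for i
    have "card K \<le> card (\<Union>(R' ` K))" if K: "K \<subseteq> I - J" for K
    proof -
      have finK: "finite K" using K fin by (meson finite_Diff finite_subset)
      have eq: "\<Union>(R ` (K \<union> J)) = \<Union>(R' ` K) \<union> ?U" unfolding R'_def by auto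
      have "card K + card J = card (K \<union> J)"
        using K finK finJ by (subst card_Un_disjoint) auto
      also have "\<dots> \<le> card (\<Union>(R ` (K \<union> J)))" using hall[of "K \<union> J"] K J by auto
      also have "\<dots> \<le> card (\<Union>(R' ` K)) + card ?U" unfolding eq by (rule card_Un_le)
      finally show ?thesis using tight by linarith
    qed
    moreover have "card (I - J) < card I"
      using tight fin finJ J by (intro psubset_card_mono) auto
    moreover have "\<And>i. i \<in> I - J \<Longrightarrow> finite (R' i)" unfolding R'_def using finR by auto
    ultimately obtain g where g: "inj_on g (I - J)" "\<forall>i\<in>I - J. g i \<in> R' i"
      using less.hyps[of "I - J" R'] fin by blast
    let ?h = "\<lambda>i. if i \<in> J then f i else g i"
    have "inj_on ?h I"
    proof (rule inj_onI)
      fix i j assume ij: "i \<in> I" "j \<in> I" "?h i = ?h j"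
      have sep: "f a \<noteq> g b" if "a \<in> J" "b \<in> I - J" for a b
        using f(2) g(2) that unfolding R'_def by (metis DiffD2 UN_I)
      show "i = j"
        using ij sep[of i j] sep[of j i] inj_onD[OF f(1), of i j] inj_onD[OF g(1), of i j]
        by (auto split: if_splits)
    qed
    moreover have "\<forall>i\<in>I. ?h i \<in> R i" using f g unfolding R'_def by auto
    ultimately show ?thesis by blast
  next
    case loose
    have "card {i} \<le> card (\<Union>(R ` {i}))" using hall[of "{i}"] loose by blast
    then obtain y where y: "y \<in> R i" by (cases "R i = {}") auto
    define R' where "R' j = R j - {y}" for j
    have "card K \<le> card (\<Union>(R' ` K))" if K: "K \<subseteq> I - {i}" for K
    proof (cases "K = {}")
      case False
      have eq: "\<Union>(R' ` K) = \<Union>(R ` K) - {y}" unfolding R'_def by auto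
      have "K \<subset> I" using K loose by auto
      then have "card K < card (\<Union>(R ` K))" using loose False by blast
      then show ?thesis unfolding eq by (auto simp: card_Diff_singleton_if)
    qed simp
    moreover have "card (I - {i}) < card I" using loose fin by (intro card_Diff1_less) auto
    moreover have "\<And>j. j \<in> I - {i} \<Longrightarrow> finite (R' j)" unfolding R'_def using finR by auto
    ultimately obtain g where g: "inj_on g (I - {i})" "\<forall>j\<in>I - {i}. g j \<in> R' j"
      using less.hyps[of "I - {i}" R'] fin by blast
    let ?h = "g(i := y)"
    have "inj_on ?h I" using g unfolding inj_on_def R'_def by auto
    moreover have "\<forall>j\<in>I. ?h j \<in> R j" using g y unfolding R'_def by auto
    ultimately show ?thesis by blast
  qed
qed

lemma sum_clamp:
  fixes v :: real
  assumes "0 \<le> v"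
  shows "(\<Sum>x<m. max 0 (min 1 (v - real x))) = min v (real m)"
  using assms by (induction m) auto

lemma line_transport:
  fixes p r :: real and H \<rho> :: nat
  assumes "0 \<le> p" "0 \<le> r" and bal: "\<bar>p - r\<bar> * real H \<le> (p + r) * (real \<rho> - 1)"
    and A: "A \<subseteq> {..<2 * H}"
  shows "real (card A) * ((p + r) / 2) \<le>
    (\<Sum>y | y < 2 * H \<and> (\<exists>x\<in>A. \<bar>int x - int y\<bar> \<le> int \<rho>). if y < H then p else r)"
proof (cases "p + r = 0")
  case True
  then show ?thesis using assms by (auto intro!: sum_nonneg)
next
  case False
  define s where "s = p + r"
  have s: "s > 0" using assms False unfolding s_def by linarith
  \<comment> \<open>\<open>F\<close> is the cumulative weight of the second distribution, normalised to end at \<open>2 * H\<close>; cell \<open>x\<close> sends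
    to cell \<open>y\<close> the length \<open>w x y\<close> of the overlap of \<open>[x, x + 1]\<close> and \<open>[F y, F (y + 1)]\<close>.\<close>
  define F :: "nat \<Rightarrow> real" where
    "F y = (if y \<le> H then 2 * p * real y / s else 2 * real H - 2 * r * (2 * real H - real y) / s)" for y
  define cl :: "nat \<Rightarrow> real \<Rightarrow> real" where "cl x v = max 0 (min 1 (v - real x))" for x v
  define w where "w x y = cl x (F (Suc y)) - cl x (F y)" for x y
  define B where "B = {y. y < 2 * H \<and> (\<exists>x\<in>A. \<bar>int x - int y\<bar> \<le> int \<rho>)}"
  have p: "p = s - r" unfolding s_def by simp
  have F0: "F 0 = 0" unfolding F_def by simp
  have FH: "F (2 * H) = 2 * real H" unfolding F_def by auto
  have Fstep: "F (Suc y) - F y = 2 * (if y < H then p else r) / s" for y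
  proof (cases "y = H")
    case True
    then show ?thesis using s unfolding F_def p by (auto simp: field_simps)
  next
    case False
    then show ?thesis using s unfolding F_def by (auto simp: field_simps)
  qed
  have Fmono: "F y \<le> F (Suc y)" for y
  proof -
    have "0 \<le> F (Suc y) - F y" unfolding Fstep using assms s by auto
    then show ?thesis by simp
  qed
  then have "mono F" by (simp add: mono_iff_le_Suc)
  then have Frange: "0 \<le> F y" "y \<le> 2 * H \<Longrightarrow> F y \<le> 2 * real H" for y
    using F0 FH by (metis monoD le0, metis monoD)
  have bal': "\<bar>p - r\<bar> * real H / s \<le> real \<rho> - 1"
    using bal s unfolding s_def by (simp add: field_simps)
  have Fdist: "\<bar>F y - real y\<bar> \<le> real \<rho> - 1" if "y \<le> 2 * H" for y
  proof -
    have "\<bar>F y - real y\<bar> \<le> \<bar>p - r\<bar> * real H / s"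
    proof (cases "y \<le> H")
      case True
      have "F y - real y = (p - r) * real y / s"
        using True s unfolding F_def p by (simp add: field_simps)
      then have "\<bar>F y - real y\<bar> = \<bar>p - r\<bar> * real y / s"
        using s by (simp add: abs_mult)
      also have "\<dots> \<le> \<bar>p - r\<bar> * real H / s"
        using True s by (intro divide_right_mono mult_left_mono) auto
      finally show ?thesis .
    next
      case H: False
      have "F y - real y = (p - r) * (2 * real H - real y) / s"
        using H s unfolding F_def p by (simp add: field_simps)
      then have "\<bar>F y - real y\<bar> = \<bar>p - r\<bar> * (2 * real H - real y) / s"
        using s that by (simp add: abs_mult)
      also have "\<dots> \<le> \<bar>p - r\<bar> * real H / s"
        using H s by (intro divide_right_mono mult_left_mono) auto
      finally show ?thesis .
    qed
    then show ?thesis using bal' by linarith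
  qed
  have w0: "0 \<le> w x y" for x y
    unfolding w_def cl_def using Fmono[of y] by auto
  have wrow: "(\<Sum>y<2*H. w x y) = 1" if "x < 2 * H" for x
  proof -
    have "(\<Sum>y<2*H. w x y) = cl x (F (2 * H)) - cl x (F 0)"
      unfolding w_def by (rule sum_lessThan_telescope)
    then show ?thesis unfolding FH F0 cl_def using that by auto
  qed
  have wcol: "(\<Sum>x<2*H. w x y) = 2 * (if y < H then p else r) / s" if "y < 2 * H" for y
  proof -
    have "(\<Sum>x<2*H. w x y) = min (F (Suc y)) (real (2*H)) - min (F y) (real (2*H))"
      unfolding w_def cl_def sum_subtractf using Frange(1) by (simp only: sum_clamp)
    also have "\<dots> = F (Suc y) - F y" using Frange(2)[of y] Frange(2)[of "Suc y"] that by auto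
    finally show ?thesis unfolding Fstep .
  qed
  have wsupp: "y \<in> B" if "x \<in> A" "y < 2 * H" "w x y \<noteq> 0" for x y
  proof -
    have "F (Suc y) > real x" "F y < real x + 1"
      using that(3) Fmono[of y] unfolding w_def cl_def by (auto simp: max_def min_def split: if_splits)
    then have "\<bar>int x - int y\<bar> \<le> int \<rho>"
      using Fdist[of y] Fdist[of "Suc y"] that(2) by linarith
    then show ?thesis using that unfolding B_def by auto
  qed
  have BH: "B \<subseteq> {..<2*H}" unfolding B_def by auto
  have "real (card A) = (\<Sum>x\<in>A. \<Sum>y<2*H. w x y)" using A wrow by (simp add: subset_iff)
  also have "\<dots> = (\<Sum>x\<in>A. \<Sum>y\<in>B. w x y)"
    by (intro sum.cong refl sum.mono_neutral_right) (use wsupp BH in auto)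
  also have "\<dots> \<le> (\<Sum>x<2*H. \<Sum>y\<in>B. w x y)"
    by (intro sum_mono2 sum_nonneg w0 A) auto
  also have "\<dots> = (\<Sum>y\<in>B. \<Sum>x<2*H. w x y)" by (rule sum.swap)
  also have "\<dots> = (\<Sum>y\<in>B. 2 * (if y < H then p else r) / s)"
    using wcol BH by (intro sum.cong) auto
  also have "\<dots> = (\<Sum>y\<in>B. if y < H then p else r) * (2 / s)"
    by (subst sum_distrib_right) (intro sum.cong, auto)
  finally show ?thesis
    using s unfolding B_def[symmetric] s_def[symmetric] by (simp add: field_simps)
qed

subsection \<open>Transport between dyadic refinements\<close>

text \<open>
  \<open>lf s i < 2 ^ k\<close> is the \<open>i\<close>-th coordinate of the leaf containing \<open>s\<close>. Boxes are described by an exponent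
  vector \<open>E\<close>: two leaves lie in the same box if their coordinates agree after division by \<open>2 ^ E i\<close>. The
  fine grid \<open>{..<n * 2 ^ k}^d\<close> refines both cubes at once: \<open>x div n\<close> is the leaf of \<open>x\<close>, and
  \<open>x div 2 ^ k\<close> is its target point. \<open>mass\<close> spreads the points in each box uniformly over the box;
  the constant factor \<open>n ^ d\<close> is omitted from the denominator.
\<close>

definition box_count :: "nat \<Rightarrow> ('a \<Rightarrow> nat \<Rightarrow> nat) \<Rightarrow> 'a set \<Rightarrow> (nat \<Rightarrow> nat) \<Rightarrow> (nat \<Rightarrow> nat) \<Rightarrow> nat" where
  "box_count d lf S E v = card {s \<in> S. \<forall>i<d. lf s i div 2 ^ E i = v i div 2 ^ E i}"

definition mass :: "nat \<Rightarrow> nat \<Rightarrow> ('a \<Rightarrow> nat \<Rightarrow> nat) \<Rightarrow> 'a set \<Rightarrow> (nat \<Rightarrow> nat) \<Rightarrow> (nat \<Rightarrow> nat) set \<Rightarrow> real" where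
  "mass d n lf S E A = (\<Sum>x\<in>A. real (box_count d lf S E (\<lambda>i. x i div n)) / (\<Prod>i<d. 2 ^ E i))"

definition fgrid :: "nat \<Rightarrow> nat \<Rightarrow> nat \<Rightarrow> (nat \<Rightarrow> nat) set" where
  "fgrid d n k = PiE {..<d} (\<lambda>_. {..<n * 2 ^ k})"

definition nbhd :: "nat \<Rightarrow> (nat \<Rightarrow> nat) set \<Rightarrow> nat \<Rightarrow> (nat \<Rightarrow> nat) set \<Rightarrow> (nat \<Rightarrow> nat) set" where
  "nbhd d X \<rho> A = {y \<in> X. \<exists>x\<in>A. \<forall>i<d. \<bar>int (x i) - int (y i)\<bar> \<le> int \<rho>}"

lemma finite_fgrid: "finite (fgrid d n k)"
  unfolding fgrid_def by (intro finite_PiE) auto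

lemma nbhd_subset: "nbhd d X \<rho> A \<subseteq> X"
  unfolding nbhd_def by auto

lemma nbhd_0: "A \<subseteq> X \<Longrightarrow> A \<subseteq> nbhd d X 0 A"
  unfolding nbhd_def by auto

lemma nbhd_nbhd: "nbhd d X \<rho> (nbhd d X \<sigma> A) \<subseteq> nbhd d X (\<rho> + \<sigma>) A"
proof
  fix z assume "z \<in> nbhd d X \<rho> (nbhd d X \<sigma> A)"
  then obtain x y where xy: "z \<in> X" "x \<in> A" "\<And>i. i < d \<Longrightarrow> \<bar>int (x i) - int (y i)\<bar> \<le> int \<sigma>"
    "\<And>i. i < d \<Longrightarrow> \<bar>int (y i) - int (z i)\<bar> \<le> int \<rho>"
    unfolding nbhd_def by auto
  have "\<bar>int (x i) - int (z i)\<bar> \<le> int (\<rho> + \<sigma>)" if "i < d" for i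
    using xy(3,4)[OF that] by linarith
  then show "z \<in> nbhd d X (\<rho> + \<sigma>) A" using xy unfolding nbhd_def by blast
qed

lemma mass_mono:
  assumes "A \<subseteq> B" "finite B"
  shows "mass d n lf S E A \<le> mass d n lf S E B"
  unfolding mass_def using assms by (intro sum_mono2) (auto intro!: divide_nonneg_nonneg prod_nonneg)

lemma mass_cong:
  assumes "\<And>i. i < d \<Longrightarrow> E i = E' i"
  shows "mass d n lf S E = mass d n lf S E'"
proof -
  have "box_count d lf S E = box_count d lf S E'"
    unfolding box_count_def using assms by (intro ext arg_cong[where f = card] Collect_cong) auto
  moreover have "(\<Prod>i<d. (2::real) ^ E i) = (\<Prod>i<d. 2 ^ E' i)" using assms by (intro prod.cong) auto
  ultimately show ?thesis unfolding mass_def by (intro ext) simp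
qed

lemma box_count_halves:
  assumes "finite S" "t < d" "E t = h" "2 ^ Suc h dvd v t"
  shows "box_count d lf S (E(t := Suc h)) v =
    box_count d lf S E v + box_count d lf S E (v(t := v t + 2 ^ h))"
proof -
  obtain b where b: "v t = 2 ^ Suc h * b" using assms(4) by (elim dvdE)
  have half: "a div (2::nat) ^ Suc h = c \<longleftrightarrow> a div 2 ^ h = 2 * c \<or> a div 2 ^ h = 2 * c + 1" for a c
  proof -
    have "a div 2 ^ Suc h = a div 2 ^ h div 2" by (metis div_mult2_eq power_Suc2)
    then show ?thesis by auto
  qed
  have vt: "v t div 2 ^ Suc h = b" "v t div 2 ^ h = 2 * b" "(v t + 2 ^ h) div 2 ^ h = 2 * b + 1"
    unfolding b by simp_all
  let ?L = "{s \<in> S. \<forall>i<d. lf s i div 2 ^ E i = v i div 2 ^ E i}"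
  let ?R = "{s \<in> S. \<forall>i<d. lf s i div 2 ^ E i = (v(t := v t + 2 ^ h)) i div 2 ^ E i}"
  have "{s \<in> S. \<forall>i<d. lf s i div 2 ^ (E(t := Suc h)) i = v i div 2 ^ (E(t := Suc h)) i} = ?L \<union> ?R"
  proof -
    have split_t: "(\<forall>i<d. Q i) \<longleftrightarrow> (\<forall>i<d. i \<noteq> t \<longrightarrow> Q i) \<and> Q t" for Q using assms(2) by blast
    have "(\<forall>i<d. lf s i div 2 ^ (E(t := Suc h)) i = v i div 2 ^ (E(t := Suc h)) i) \<longleftrightarrow>
      (\<forall>i<d. lf s i div 2 ^ E i = v i div 2 ^ E i) \<or>
      (\<forall>i<d. lf s i div 2 ^ E i = (v(t := v t + 2 ^ h)) i div 2 ^ E i)" for s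
      unfolding split_t[of "\<lambda>i. lf s i div 2 ^ (E(t := Suc h)) i = v i div 2 ^ (E(t := Suc h)) i"]
        split_t[of "\<lambda>i. lf s i div 2 ^ E i = v i div 2 ^ E i"]
        split_t[of "\<lambda>i. lf s i div 2 ^ E i = (v(t := v t + 2 ^ h)) i div 2 ^ E i"]
      using half[of "lf s t" b] vt assms(3) by (simp del: power_Suc cong: conj_cong) blast
    then show ?thesis by blast
  qed
  moreover have "?L \<inter> ?R = {}"
    using vt assms(2,3) by (auto dest!: spec[of _ t])
  ultimately show ?thesis
    unfolding box_count_def using assms(1) by (simp add: card_Un_disjoint)
qed

lemma mass_step:
  assumes "finite S" "t < d" "0 < n" "h < k" "E t = h"
    and A: "A \<subseteq> fgrid d n k"
    and bal: "\<And>v. (\<And>i. i < d \<Longrightarrow> v i < 2 ^ k) \<Longrightarrow> 2 ^ Suc h dvd v t \<Longrightarrow>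
      \<bar>real (box_count d lf S E v) - real (box_count d lf S E (v(t := v t + 2 ^ h)))\<bar> * real (n * 2 ^ h)
      \<le> (real (box_count d lf S E v) + real (box_count d lf S E (v(t := v t + 2 ^ h)))) * (real \<rho> - 1)"
  shows "mass d n lf S (E(t := Suc h)) A \<le> mass d n lf S E (nbhd d (fgrid d n k) \<rho> A)"
proof -
  define X where "X = fgrid d n k"
  define H where "H = n * 2 ^ h"
  define key where "key x = x(t := x t div (2 * H))" for x :: "nat \<Rightarrow> nat"
  define line where "line \<kappa> a = \<kappa>(t := 2 * H * \<kappa> t + a)" for \<kappa> :: "nat \<Rightarrow> nat" and a
  define c where "c = (\<Prod>i<d. (2::real) ^ E i)"
  define u where "u x = real (box_count d lf S (E(t := Suc h)) (\<lambda>i. x i div n))" for x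
  define w where "w x = real (box_count d lf S E (\<lambda>i. x i div n))" for x
  define NA where "NA = nbhd d X \<rho> A"
  have H: "H > 0" and c: "c > 0" using assms unfolding H_def c_def by (auto intro!: prod_pos)
  have finX: "finite X" unfolding X_def by (rule finite_fgrid)
  have finA: "finite A" and finNA: "finite NA" "NA \<subseteq> X"
    using A finX finite_subset nbhd_subset unfolding X_def NA_def by metis+
  have c2: "(\<Prod>i<d. (2::real) ^ (E(t := Suc h)) i) = 2 * c"
  proof -
    have "(\<Prod>i\<in>{..<d}-{t}. (2::real) ^ (E(t := Suc h)) i) = (\<Prod>i\<in>{..<d}-{t}. 2 ^ E i)"
      by (intro prod.cong) auto
    then show ?thesis unfolding c_def using assms by (simp add: prod.remove[of "{..<d}" t])
  qed
  have fibre: "{x \<in> B. key x = \<kappa>} = line \<kappa> ` {a. a < 2 * H \<and> line \<kappa> a \<in> B}" for B \<kappa>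
  proof (intro equalityI subsetI)
    fix x assume x: "x \<in> {x \<in> B. key x = \<kappa>}"
    then have \<kappa>: "\<kappa> = x(t := x t div (2 * H))" unfolding key_def by auto
    have "x = line \<kappa> (x t mod (2 * H))" unfolding line_def \<kappa> by (auto simp: fun_eq_iff)
    then show "x \<in> line \<kappa> ` {a. a < 2 * H \<and> line \<kappa> a \<in> B}"
      using x H by (intro image_eqI[where x = "x t mod (2 * H)"]) auto
  next
    fix x assume "x \<in> line \<kappa> ` {a. a < 2 * H \<and> line \<kappa> a \<in> B}"
    then show "x \<in> {x \<in> B. key x = \<kappa>}" unfolding line_def key_def by (auto simp: fun_eq_iff)
  qed
  have inj: "inj_on (line \<kappa>) Y" for \<kappa> Y
    unfolding inj_on_def line_def by (metis add_left_cancel fun_upd_same)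
  have sum_fibres: "(\<Sum>x\<in>B. g x) = (\<Sum>\<kappa>\<in>key ` X. \<Sum>a | a < 2 * H \<and> line \<kappa> a \<in> B. g (line \<kappa> a))"
    if "B \<subseteq> X" for B and g :: "(nat \<Rightarrow> nat) \<Rightarrow> real"
  proof -
    have "(\<Sum>x\<in>B. g x) = (\<Sum>\<kappa>\<in>key ` X. sum g {x \<in> B. key x = \<kappa>})"
      using that finX finite_subset by (intro sum.group[symmetric]) auto
    also have "\<dots> = (\<Sum>\<kappa>\<in>key ` X. \<Sum>a | a < 2 * H \<and> line \<kappa> a \<in> B. g (line \<kappa> a))"
      unfolding fibre by (simp add: sum.reindex[OF inj])
    finally show ?thesis .
  qed
  have line: "(\<Sum>a | a < 2 * H \<and> line \<kappa> a \<in> A. u (line \<kappa> a) / 2) \<le>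
      (\<Sum>a | a < 2 * H \<and> line \<kappa> a \<in> NA. w (line \<kappa> a))" if \<kappa>: "\<kappa> \<in> key ` X" for \<kappa>
  proof -
    obtain x where x: "x \<in> X" "\<kappa> = key x" using \<kappa> by auto
    define v where "v = (\<lambda>i. line \<kappa> 0 i div n)"
    define p where "p = real (box_count d lf S E v)"
    define r where "r = real (box_count d lf S E (v(t := v t + 2 ^ h)))"
    have vt: "v t = 2 ^ Suc h * \<kappa> t" using \<open>0 < n\<close> unfolding v_def line_def H_def by simp
    have "line \<kappa> 0 i \<le> x i" for i unfolding line_def x key_def by simp
    moreover have "x i < n * 2 ^ k" if "i < d" for i
      using x that unfolding X_def fgrid_def by (auto simp: PiE_iff)
    ultimately have vk: "v i < 2 ^ k" if "i < d" for i
      using that unfolding v_def by (metis less_mult_imp_div_less mult.commute order_le_less_trans)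
    have lt: "line \<kappa> a t div n div 2 ^ h = 2 * \<kappa> t + a div H" for a
    proof -
      have "line \<kappa> a t div n div 2 ^ h = (H * (2 * \<kappa> t) + a) div H"
        unfolding line_def H_def by (simp add: div_mult2_eq mult_ac)
      also have "\<dots> = 2 * \<kappa> t + a div H" using H by (subst div_mult_self4) auto
      finally show ?thesis .
    qed
    have lo: "line \<kappa> a i div n = v i" if "i \<noteq> t" for a i
      using that unfolding line_def v_def by simp
    have vth: "v t div 2 ^ h = 2 * \<kappa> t" "(v t + 2 ^ h) div 2 ^ h = 2 * \<kappa> t + 1" unfolding vt by simp_all
    have uline: "u (line \<kappa> a) = p + r" if "a < 2 * H" for a
    proof -
      have "a div H < 2" using that by (simp add: less_mult_imp_div_less)
      then have "line \<kappa> a t div n div 2 ^ Suc h = \<kappa> t"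
        using lt[of a] by (simp only: power_Suc2 div_mult2_eq)
      then have "u (line \<kappa> a) = real (box_count d lf S (E(t := Suc h)) v)"
        unfolding u_def box_count_def using lo vt
        by (intro arg_cong[where f = "\<lambda>A. real (card A)"] Collect_cong)
           (auto simp del: power_Suc split: if_splits)
      also have "\<dots> = p + r" unfolding p_def r_def
        using assms vt by (subst box_count_halves) auto
      finally show ?thesis .
    qed
    have wline: "w (line \<kappa> a) = (if a < H then p else r)" if "a < 2 * H" for a
    proof (cases "a < H")
      case True
      have "w (line \<kappa> a) = p" unfolding w_def p_def box_count_def
        using lo lt[of a] vth True \<open>E t = h\<close>
        by (intro arg_cong[where f = "\<lambda>A. real (card A)"] Collect_cong) (metis add.right_neutral div_less)
      then show ?thesis using True by simp
    next
      case False
      have "a div H = 1" using that False by (intro div_nat_eqI) auto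
      have "w (line \<kappa> a) = r" unfolding w_def r_def box_count_def
        using lo lt[of a] vth \<open>a div H = 1\<close> \<open>E t = h\<close>
        by (intro arg_cong[where f = "\<lambda>A. real (card A)"] Collect_cong) (metis fun_upd_apply)
      then show ?thesis using False by simp
    qed
    let ?A = "{a. a < 2 * H \<and> line \<kappa> a \<in> A}"
    let ?B = "{a. a < 2 * H \<and> line \<kappa> a \<in> NA}"
    have "(\<Sum>a\<in>?A. u (line \<kappa> a) / 2) = (\<Sum>a\<in>?A. (p + r) / 2)"
      using uline by (intro sum.cong) auto
    also have "\<dots> = real (card ?A) * ((p + r) / 2)" by simp
    also have "\<dots> \<le> (\<Sum>y | y < 2 * H \<and> (\<exists>x\<in>?A. \<bar>int x - int y\<bar> \<le> int \<rho>). if y < H then p else r)"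
      using bal[of v] vk vt unfolding p_def[symmetric] r_def[symmetric] H_def[symmetric]
      by (intro line_transport) (auto simp: p_def r_def)
    also have "\<dots> \<le> (\<Sum>y\<in>?B. if y < H then p else r)"
    proof (intro sum_mono2 subsetI)
      fix y assume "y \<in> {y. y < 2 * H \<and> (\<exists>x\<in>?A. \<bar>int x - int y\<bar> \<le> int \<rho>)}"
      then obtain a where a: "y < 2 * H" "line \<kappa> a \<in> A" "a < 2 * H" "\<bar>int a - int y\<bar> \<le> int \<rho>" by auto
      have "2 * H * (2 ^ k div 2 ^ Suc h) = n * (2 ^ Suc h * (2 ^ k div 2 ^ Suc h))"
        unfolding H_def by simp
      also have "\<dots> = n * 2 ^ k"
        using \<open>h < k\<close> by (subst dvd_mult_div_cancel) (auto intro!: le_imp_power_dvd simp del: power_Suc)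
      finally have N: "2 * H * (2 ^ k div 2 ^ Suc h) = n * 2 ^ k" .
      have "x t < 2 * H * (2 ^ k div 2 ^ Suc h)"
        unfolding N using x(1) \<open>t < d\<close> unfolding X_def fgrid_def by (auto simp: PiE_iff)
      then have "\<kappa> t < 2 ^ k div 2 ^ Suc h" unfolding x key_def
        using H by (simp add: less_mult_imp_div_less mult.commute)
      then have "2 * H * (\<kappa> t + 1) \<le> 2 * H * (2 ^ k div 2 ^ Suc h)" by (intro mult_le_mono2) simp
      also have "\<dots> = n * 2 ^ k" by (rule N)
      finally have "2 * H * \<kappa> t + y < n * 2 ^ k" using a by (simp add: algebra_simps)
      then have "line \<kappa> y \<in> X"
        using x \<open>t < d\<close> unfolding line_def x key_def X_def fgrid_def by (auto simp: PiE_iff extensional_def)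
      moreover have "\<bar>int (line \<kappa> a i) - int (line \<kappa> y i)\<bar> \<le> int \<rho>" for i
        using a unfolding line_def by auto
      ultimately have "line \<kappa> y \<in> NA" using a unfolding NA_def nbhd_def by auto
      then show "y \<in> ?B" using a by simp
    qed (auto simp: p_def r_def)
    also have "\<dots> = (\<Sum>a\<in>?B. w (line \<kappa> a))" using wline by (intro sum.cong) auto
    finally show ?thesis .
  qed
  have "mass d n lf S (E(t := Suc h)) A = (\<Sum>x\<in>A. u x / 2) / c"
    unfolding mass_def c2 u_def by (simp add: sum_divide_distrib)
  also have "\<dots> \<le> (\<Sum>x\<in>NA. w x) / c"
    using A finNA line c unfolding X_def[symmetric]
    by (intro divide_right_mono) (auto simp: sum_fibres intro!: sum_mono)
  also have "\<dots> = mass d n lf S E NA" unfolding mass_def w_def c_def by (simp add: sum_divide_distrib)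
  finally show ?thesis unfolding NA_def X_def .
qed

text \<open>
  The exponent vector in between scales \<open>Suc h\<close> and \<open>h\<close>, with the first \<open>t\<close> coordinates already halved.
\<close>

definition expo :: "nat \<Rightarrow> nat \<Rightarrow> nat \<Rightarrow> nat" where
  "expo h t i = (if i < t then h else Suc h)"

definition mean_count :: "nat \<Rightarrow> nat \<Rightarrow> nat \<Rightarrow> (nat \<Rightarrow> nat) \<Rightarrow> real" where
  "mean_count d n k E = real n ^ d * (\<Prod>i<d. 2 ^ E i) / (2 ^ k) ^ d"

definition balanced :: "nat \<Rightarrow> nat \<Rightarrow> nat \<Rightarrow> ('a \<Rightarrow> nat \<Rightarrow> nat) \<Rightarrow> 'a set \<Rightarrow> bool" where
  "balanced d n k lf S \<longleftrightarrow> (\<forall>h<k. \<forall>t<d. \<forall>v. (\<forall>i<d. v i < 2 ^ k) \<longrightarrow>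
     \<bar>real (box_count d lf S (expo h (Suc t)) v) - mean_count d n k (expo h (Suc t))\<bar>
       \<le> mean_count d n k (expo h (Suc t)) / (4 * real k * 2 ^ h))"

lemma mass_level:
  assumes "finite S" "0 < n" "4 * k \<le> n" "h < k" and A: "A \<subseteq> fgrid d n k"
    and bal: "balanced d n k lf S" and "t \<le> d"
  shows "mass d n lf S (\<lambda>_. Suc h) A \<le> mass d n lf S (expo h t) (nbhd d (fgrid d n k) (t * (n div k)) A)"
  using \<open>t \<le> d\<close>
proof (induction t)
  case 0
  have "mass d n lf S (\<lambda>_. Suc h) A \<le> mass d n lf S (\<lambda>_. Suc h) (nbhd d (fgrid d n k) 0 A)"
    using nbhd_0[OF A] finite_subset[OF nbhd_subset finite_fgrid] by (intro mass_mono) auto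
  moreover have "expo h 0 = (\<lambda>_. Suc h)" unfolding expo_def by auto
  ultimately show ?case by simp
next
  case (Suc t)
  let ?X = "fgrid d n k" and ?\<rho> = "n div k" and ?E = "expo h (Suc t)"
  let ?B = "nbhd d ?X (t * ?\<rho>) A"
  have E: "expo h t = ?E(t := Suc h)" unfolding expo_def by (auto simp: fun_eq_iff)
  have k: "0 < k" using \<open>h < k\<close> by simp
  have step: "\<bar>real (box_count d lf S ?E v) - real (box_count d lf S ?E (v(t := v t + 2 ^ h)))\<bar> * real (n * 2 ^ h)
      \<le> (real (box_count d lf S ?E v) + real (box_count d lf S ?E (v(t := v t + 2 ^ h)))) * (real ?\<rho> - 1)"
    if v: "\<And>i. i < d \<Longrightarrow> v i < 2 ^ k" and dv: "2 ^ Suc h dvd v t" for v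
  proof -
    define \<mu> where "\<mu> = mean_count d n k ?E"
    define \<epsilon> where "\<epsilon> = 1 / (4 * real k * 2 ^ h)"
    define p where "p = real (box_count d lf S ?E v)"
    define r where "r = real (box_count d lf S ?E (v(t := v t + 2 ^ h)))"
    have "2 ^ Suc h dvd (2 ^ k :: nat)" using \<open>h < k\<close> by (intro le_imp_power_dvd) auto
    then have "2 ^ Suc h dvd 2 ^ k - v t" using dv by (rule dvd_diff_nat)
    moreover have "0 < 2 ^ k - v t" using v[of t] Suc.prems by simp
    ultimately have "2 ^ Suc h \<le> 2 ^ k - v t" by (rule dvd_imp_le)
    moreover have "(2::nat) ^ h < 2 ^ Suc h" by simp
    ultimately have vt: "v t + 2 ^ h < 2 ^ k" by linarith
    have \<mu>0: "0 \<le> \<mu>" unfolding \<mu>_def mean_count_def by (intro divide_nonneg_nonneg mult_nonneg_nonneg prod_nonneg) auto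
    have "1 * 1 \<le> real k * 2 ^ h" using k by (intro mult_mono) auto
    then have \<epsilon>: "\<epsilon> \<le> 1 / 4" "0 \<le> \<epsilon>" unfolding \<epsilon>_def by (auto simp: divide_simps)
    have P: "\<bar>p - \<mu>\<bar> \<le> \<mu> * \<epsilon>" "\<bar>r - \<mu>\<bar> \<le> \<mu> * \<epsilon>"
      using bal \<open>h < k\<close> Suc.prems v vt unfolding balanced_def p_def r_def \<mu>_def \<epsilon>_def by auto
    have me: "\<mu> * \<epsilon> \<le> \<mu> * (1 / 4)" using \<mu>0 \<epsilon> by (intro mult_left_mono) auto
    have \<rho>: "real n / (2 * real k) \<le> real ?\<rho> - 1"
    proof -
      have "n < k * (?\<rho> + 1)" using k by (metis add.commute dividend_less_div_times mult.commute mult_Suc_right plus_1_eq_Suc)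
      then have "real n < real k * (real ?\<rho> + 1)" by (metis of_nat_1 of_nat_add of_nat_less_iff of_nat_mult)
      moreover have "4 * real k \<le> real n" using assms(3) by linarith
      ultimately have "real n \<le> 2 * (real k * (real ?\<rho> - 1))" by (simp add: algebra_simps)
      then show ?thesis using k by (simp add: field_simps)
    qed
    have "\<bar>p - r\<bar> * real (n * 2 ^ h) \<le> 2 * (\<mu> * \<epsilon>) * real (n * 2 ^ h)"
      using P by (intro mult_right_mono) linarith+
    also have "\<dots> = \<mu> * (real n / (2 * real k))" unfolding \<epsilon>_def using k by (simp add: field_simps)
    also have "\<dots> \<le> (p + r) * (real ?\<rho> - 1)"
    proof (rule mult_mono)
      show "\<mu> \<le> p + r" using P me by linarith
    qed (use \<rho> in \<open>auto simp: p_def r_def\<close>)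
    finally show ?thesis unfolding p_def r_def .
  qed
  have "mass d n lf S (\<lambda>_. Suc h) A \<le> mass d n lf S (?E(t := Suc h)) ?B"
    unfolding E[symmetric] using Suc.IH Suc.prems by simp
  also have "\<dots> \<le> mass d n lf S ?E (nbhd d ?X ?\<rho> ?B)"
    using assms Suc.prems step nbhd_subset by (intro mass_step) (auto simp: expo_def)
  also have "\<dots> \<le> mass d n lf S ?E (nbhd d ?X (Suc t * ?\<rho>) A)"
    using nbhd_nbhd[of d ?X ?\<rho> "t * ?\<rho>" A] finite_subset[OF nbhd_subset finite_fgrid]
    by (intro mass_mono) (auto simp: add.commute)
  finally show ?case .
qed

lemma mass_transport:
  assumes "finite S" "0 < n" "4 * k \<le> n" and A: "A \<subseteq> fgrid d n k"
    and bal: "balanced d n k lf S"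
  shows "mass d n lf S (\<lambda>_. k) A \<le> mass d n lf S (\<lambda>_. 0) (nbhd d (fgrid d n k) (k * d * (n div k)) A)"
proof -
  let ?X = "fgrid d n k" and ?\<rho> = "n div k"
  have "mass d n lf S (\<lambda>_. k) A \<le> mass d n lf S (\<lambda>_. k - j) (nbhd d ?X (j * d * ?\<rho>) A)" if "j \<le> k" for j
    using that
  proof (induction j)
    case 0
    then show ?case
      using nbhd_0[OF A] finite_subset[OF nbhd_subset finite_fgrid] by (auto intro!: mass_mono)
  next
    case (Suc j)
    define h where "h = k - Suc j"
    have h: "h < k" "k - j = Suc h" using Suc.prems unfolding h_def by auto
    let ?B = "nbhd d ?X (j * d * ?\<rho>) A"
    have "mass d n lf S (\<lambda>_. k) A \<le> mass d n lf S (\<lambda>_. Suc h) ?B"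
      using Suc.IH Suc.prems unfolding h(2) by simp
    also have "\<dots> \<le> mass d n lf S (expo h d) (nbhd d ?X (d * ?\<rho>) ?B)"
      using assms h nbhd_subset by (intro mass_level) auto
    also have "mass d n lf S (expo h d) = mass d n lf S (\<lambda>_. h)"
      by (intro mass_cong) (auto simp: expo_def)
    also have "mass d n lf S (\<lambda>_. h) (nbhd d ?X (d * ?\<rho>) ?B) \<le> mass d n lf S (\<lambda>_. h) (nbhd d ?X (Suc j * d * ?\<rho>) A)"
      using nbhd_nbhd[of d ?X "d * ?\<rho>" "j * d * ?\<rho>" A] finite_subset[OF nbhd_subset finite_fgrid]
      by (intro mass_mono) (auto simp: algebra_simps)
    finally show ?case unfolding h_def .
  qed
  from this[of k] show ?thesis by simp
qed

lemma card_block: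
  assumes "0 < m" "\<And>i. i < d \<Longrightarrow> (z i + 1) * m \<le> P"
  shows "card {x \<in> PiE {..<d} (\<lambda>_. {..<P}). \<forall>i<d. x i div m = z i} = (m::nat) ^ d"
proof -
  have "a < P \<and> a div m = z i \<longleftrightarrow> a \<in> {z i * m..<z i * m + m}" if "i < d" for a i
  proof
    assume "a \<in> {z i * m..<z i * m + m}"
    then have "m * z i \<le> a" "a < m * Suc (z i)" by (auto simp: mult.commute)
    moreover have "m * Suc (z i) \<le> P" using assms(2)[OF that] by (simp add: algebra_simps)
    ultimately show "a < P \<and> a div m = z i" using div_nat_eqI by auto
  next
    assume "a < P \<and> a div m = z i"
    then have "a = z i * m + a mod m" by (metis div_mult_mod_eq)
    then show "a \<in> {z i * m..<z i * m + m}"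
      using mod_less_divisor[OF assms(1), of a] by (metis atLeastLessThan_iff le_add1 nat_add_left_cancel_less)
  qed
  then have "{x \<in> PiE {..<d} (\<lambda>_. {..<P}). \<forall>i<d. x i div m = z i} = PiE {..<d} (\<lambda>i. {z i * m..<z i * m + m})"
    unfolding PiE_def Pi_def by (intro set_eqI) (auto simp: Ball_def)
  then show ?thesis by (simp add: card_PiE)
qed

lemma ex_matching:
  fixes lf :: "'a \<Rightarrow> nat \<Rightarrow> nat"
  assumes S: "finite S" "card S = n ^ d" and n: "0 < n" "4 * k \<le> n"
    and lf: "\<And>s i. s \<in> S \<Longrightarrow> i < d \<Longrightarrow> lf s i < 2 ^ k"
    and bal: "balanced d n k lf S"
  shows "\<exists>f. inj_on f (PiE {..<d} (\<lambda>_. {..<n})) \<and> (\<forall>z\<in>PiE {..<d} (\<lambda>_. {..<n}). f z \<in> S \<and>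
    (\<forall>i<d. \<bar>2 ^ k * int (z i) - int n * int (lf (f z) i)\<bar> \<le> int (k * d * (n div k) + 2 ^ k + n)))"
proof -
  let ?X = "fgrid d n k" and ?R = "k * d * (n div k)" and ?Z = "PiE {..<d} (\<lambda>_. {..<n})"
  define cell where "cell z = {x \<in> ?X. \<forall>i<d. x i div 2 ^ k = z i}" for z
  define leaf where "leaf s = {y \<in> ?X. \<forall>i<d. y i div n = lf s i}" for s
  define Rel where "Rel z = {s \<in> S. leaf s \<inter> nbhd d ?X ?R (cell z) \<noteq> {}}" for z
  have finX: "finite ?X" by (rule finite_fgrid)
  have finR: "finite (Rel z)" for z unfolding Rel_def using S by auto
  have hall: "card J \<le> card (\<Union>(Rel ` J))" if J: "J \<subseteq> ?Z" for J
  proof -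
    have finJ: "finite J" using J by (rule finite_subset) (auto intro: finite_PiE)
    define A where "A = \<Union>(cell ` J)"
    define B where "B = nbhd d ?X ?R A"
    have AX: "A \<subseteq> ?X" and BX: "B \<subseteq> ?X" unfolding A_def cell_def B_def nbhd_def by auto
    then have finB: "finite B" using finX finite_subset by blast
    have fin_cell: "finite (cell z)" for z unfolding cell_def using finX by auto
    have disj_cell: "cell z \<inter> cell z' = {}" if "z \<in> J" "z' \<in> J" "z \<noteq> z'" for z z'
    proof -
      have "z \<in> ?Z" "z' \<in> ?Z" using that J by auto
      then obtain i where "i < d" "z i \<noteq> z' i" using PiE_ext[of z "{..<d}" _ z'] \<open>z \<noteq> z'\<close> by blast
      then show ?thesis unfolding cell_def by auto
    qed
    have "card A = (\<Sum>z\<in>J. card (cell z))" unfolding A_def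
      using finJ fin_cell disj_cell by (intro card_UN_disjoint) simp_all
    also have "\<dots> = (\<Sum>z\<in>J. (2 ^ k) ^ d)"
    proof (intro sum.cong refl)
      fix z assume "z \<in> J"
      then have "(z i + 1) * 2 ^ k \<le> n * 2 ^ k" if "i < d" for i
        using J that by (intro mult_le_mono1) (auto simp: PiE_iff Suc_le_eq)
      then show "card (cell z) = (2 ^ k) ^ d"
        unfolding cell_def fgrid_def by (intro card_block) auto
    qed
    finally have cA: "card A = card J * (2 ^ k) ^ d" by simp
    have box_full: "box_count d lf S (\<lambda>_. k) (\<lambda>i. x i div n) = n ^ d" if "x \<in> A" for x
    proof -
      have "x i div n < 2 ^ k" if "i < d" for i
        using \<open>x \<in> A\<close> AX that unfolding fgrid_def
        by (intro less_mult_imp_div_less) (auto simp: PiE_iff mult.commute)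
      then show ?thesis unfolding box_count_def using lf S(2) by (simp cong: conj_cong)
    qed
    define U where "U = \<Union>(Rel ` J)"
    have US: "U \<subseteq> S" unfolding U_def Rel_def by auto
    have no_hit: "B \<inter> leaf s = {}" if s: "s \<in> S" "s \<notin> U" for s
    proof (rule ccontr)
      assume "B \<inter> leaf s \<noteq> {}"
      then obtain y where y: "y \<in> B" "y \<in> leaf s" by auto
      then obtain z where "z \<in> J" "y \<in> nbhd d ?X ?R (cell z)" unfolding B_def A_def nbhd_def by auto
      then have "s \<in> Rel z" using s y unfolding Rel_def by auto
      then show False using s \<open>z \<in> J\<close> unfolding U_def by auto
    qed
    have "(\<Sum>y\<in>B. card {s \<in> S. \<forall>i<d. lf s i = y i div n}) = (\<Sum>y\<in>B. card {s \<in> S. y \<in> leaf s})"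
      using BX unfolding leaf_def by (intro sum.cong refl arg_cong[where f = card]) auto
    also have "\<dots> = (\<Sum>s\<in>S. card {y \<in> B. y \<in> leaf s})"
      using sum.swap_restrict[OF finB S(1), of "\<lambda>_ _. 1::nat" "\<lambda>y s. y \<in> leaf s"] by simp
    also have "\<dots> = (\<Sum>s\<in>S. card (B \<inter> leaf s))" by (simp add: Int_def)
    also have "\<dots> = (\<Sum>s\<in>U. card (B \<inter> leaf s))"
      using S(1) US no_hit by (intro sum.mono_neutral_right) auto
    also have "\<dots> \<le> (\<Sum>s\<in>U. n ^ d)"
    proof (rule sum_mono)
      fix s assume "s \<in> U"
      then have s: "s \<in> S" using US by auto
      have "(lf s i + 1) * n \<le> n * 2 ^ k" if "i < d" for i
        using lf[OF s that] by (subst mult.commute) (intro mult_le_mono2, simp)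
      then have "card (leaf s) = n ^ d" unfolding leaf_def fgrid_def using n by (intro card_block) auto
      moreover have "finite (leaf s)" unfolding leaf_def using finX by auto
      ultimately show "card (B \<inter> leaf s) \<le> n ^ d" by (metis card_mono inf_le2)
    qed
    finally have le: "(\<Sum>y\<in>B. card {s \<in> S. \<forall>i<d. lf s i = y i div n}) \<le> card U * n ^ d"
      by simp
    have "real (card J * n ^ d) = mass d n lf S (\<lambda>_. k) A"
      unfolding mass_def using box_full cA by simp
    also have "\<dots> \<le> mass d n lf S (\<lambda>_. 0) B"
      unfolding B_def using assms AX by (intro mass_transport) auto
    also have "\<dots> = real (\<Sum>y\<in>B. card {s \<in> S. \<forall>i<d. lf s i = y i div n})"
      unfolding mass_def box_count_def by simp
    finally have "card J * n ^ d \<le> (\<Sum>y\<in>B. card {s \<in> S. \<forall>i<d. lf s i = y i div n})"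
      by (simp only: of_nat_le_iff)
    then have "card J * n ^ d \<le> card (\<Union>(Rel ` J)) * n ^ d" using le unfolding U_def by (rule order_trans)
    then show ?thesis using n by simp
  qed
  have finZ: "finite ?Z" by (intro finite_PiE) auto
  obtain f where f: "inj_on f ?Z" "\<forall>z\<in>?Z. f z \<in> Rel z"
    using hall_marriage[of ?Z Rel] finZ finR hall by blast
  have "\<bar>2 ^ k * int (z i) - int n * int (lf (f z) i)\<bar> \<le> int (?R + 2 ^ k + n)"
    if z: "z \<in> ?Z" and i: "i < d" for z i
  proof -
    obtain x y where xy: "\<bar>int (x i) - int (y i)\<bar> \<le> int ?R" "x i div 2 ^ k = z i" "y i div n = lf (f z) i"
      using f(2) z i unfolding Rel_def leaf_def nbhd_def cell_def by blast
    have "int (x i) = int (2 ^ k * (x i div 2 ^ k) + x i mod 2 ^ k)"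
      and "int (y i) = int (n * (y i div n) + y i mod n)"
      by (simp_all only: mult_div_mod_eq)
    then have "int (x i) = 2 ^ k * int (z i) + int (x i mod 2 ^ k)"
      and "int (y i) = int n * int (lf (f z) i) + int (y i mod n)"
      unfolding xy(2,3) by simp_all
    moreover have "int (x i mod 2 ^ k) < int (2 ^ k)" "int (y i mod n) < int n"
      unfolding of_nat_less_iff using n by auto
    ultimately show ?thesis using xy(1) unfolding of_nat_add by linarith
  qed
  then show ?thesis using f unfolding Rel_def by blast
qed

subsection \<open>From balanced point sets to Lipschitz bijections\<close>

definition leaf_of :: "nat \<Rightarrow> (nat \<Rightarrow> int) \<Rightarrow> nat \<Rightarrow> nat" where
  "leaf_of q s i = nat (s i - 1) div q"

lemma edist_L2: "edist d x y = L2_set (\<lambda>i. real_of_int (x i - y i)) {..<d}"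
  unfolding edist_def L2_set_def ..

lemma abs_le_edist:
  assumes "i < d" shows "\<bar>real_of_int (x i) - real_of_int (y i)\<bar> \<le> edist d x y"
proof -
  have "sqrt ((real_of_int (x i - y i))\<^sup>2) \<le> edist d x y" unfolding edist_def
    using assms by (intro real_sqrt_le_mono member_le_sum) auto
  then show ?thesis by simp
qed

lemma edist_ge_1:
  assumes "x \<in> grid d m" "y \<in> grid d m" "x \<noteq> y"
  shows "1 \<le> edist d x y"
proof -
  obtain i where i: "i < d" "x i \<noteq> y i"
    using assms PiE_ext[of x "{..<d}" _ y] unfolding grid_def by blast
  then have "1 \<le> \<bar>x i - y i\<bar>" by linarith
  then have "1 \<le> \<bar>real_of_int (x i) - real_of_int (y i)\<bar>" by linarith
  then show ?thesis using abs_le_edist[OF i(1), of x y] by linarith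
qed

lemma edist_le:
  assumes "\<And>i. i < d \<Longrightarrow> \<bar>real_of_int (x i) - real_of_int (y i)\<bar> \<le> c"
  shows "edist d x y \<le> real d * c"
proof -
  have "edist d x y \<le> (\<Sum>i<d. \<bar>real_of_int (x i - y i)\<bar>)" unfolding edist_L2 by (rule L2_set_le_sum_abs)
  also have "\<dots> \<le> (\<Sum>i<d. c)" using assms by (intro sum_mono) auto
  finally show ?thesis by simp
qed

lemma finite_grid: "finite (grid d m)"
  unfolding grid_def by (intro finite_PiE) auto

lemma Fmin_le_lip:
  assumes "finite S" "f \<in> S \<rightarrow>\<^sub>E grid d (int n)" "f ` S = grid d (int n)"
  shows "Fmin d n S \<le> lip d S f"
  unfolding Fmin_def
proof (rule Min_le)
  have "finite (S \<rightarrow>\<^sub>E grid d (int n))" using assms(1) finite_grid by (intro finite_PiE) auto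
  then have "finite (lip d S ` {f \<in> S \<rightarrow>\<^sub>E grid d (int n). f ` S = grid d (int n)})" by simp
  then show "finite {lip d S f |f. f \<in> S \<rightarrow>\<^sub>E grid d (int n) \<and> f ` S = grid d (int n)}"
    by (rule finite_subset[rotated]) auto
qed (use assms in auto)

lemma lip_le:
  assumes "finite S" "0 \<le> c"
    and "\<And>x y. x \<in> S \<Longrightarrow> y \<in> S \<Longrightarrow> x \<noteq> y \<Longrightarrow> edist d (f x) (f y) \<le> c * edist d x y"
    and "\<And>x y. x \<in> S \<Longrightarrow> y \<in> S \<Longrightarrow> x \<noteq> y \<Longrightarrow> 0 < edist d x y"
  shows "lip d S f \<le> c"
  unfolding lip_def
proof (rule Max.boundedI)
  let ?g = "\<lambda>(x, y). edist d (f x) (f y) / edist d x y"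
  have "finite (?g ` (S \<times> S))" using assms(1) by auto
  then show "finite (insert 0 {edist d (f x) (f y) / edist d x y |x y. x \<in> S \<and> y \<in> S \<and> x \<noteq> y})"
    by (simp, elim finite_subset[rotated]) auto
  fix a assume "a \<in> insert 0 {edist d (f x) (f y) / edist d x y |x y. x \<in> S \<and> y \<in> S \<and> x \<noteq> y}"
  then show "a \<le> c" using assms(2-4) by (auto simp: pos_divide_le_eq)
qed simp

lemma leaf_diff:
  fixes s s' :: "nat \<Rightarrow> int"
  assumes "0 < q" "1 \<le> s i" "1 \<le> s' i"
  shows "real q * \<bar>real (leaf_of q s i) - real (leaf_of q s' i)\<bar> \<le> \<bar>real_of_int (s i) - real_of_int (s' i)\<bar> + real q"
proof -
  have *: "s i - 1 - int q < int q * int (leaf_of q s i)" "int q * int (leaf_of q s i) \<le> s i - 1"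
    if "1 \<le> s i" for s
  proof -
    have "int (nat (s i - 1)) = int (q * (nat (s i - 1) div q) + nat (s i - 1) mod q)"
      by (simp only: mult_div_mod_eq)
    moreover have "int (nat (s i - 1) mod q) < int q" unfolding of_nat_less_iff using assms(1) by auto
    ultimately show "s i - 1 - int q < int q * int (leaf_of q s i)" "int q * int (leaf_of q s i) \<le> s i - 1"
      using that unfolding leaf_of_def of_nat_add of_nat_mult by linarith+
  qed
  have "int q * \<bar>int (leaf_of q s i) - int (leaf_of q s' i)\<bar> = \<bar>int q * int (leaf_of q s i) - int q * int (leaf_of q s' i)\<bar>"
    by (simp add: abs_mult flip: right_diff_distrib)
  also have "\<dots> \<le> \<bar>s i - s' i\<bar> + int q" using *[of s] *[of s'] assms by linarith
  finally have "real_of_int (int q * \<bar>int (leaf_of q s i) - int (leaf_of q s' i)\<bar>) \<le> real_of_int (\<bar>s i - s' i\<bar> + int q)"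
    by (rule of_int_le_iff[THEN iffD2])
  then show ?thesis by simp
qed

lemma Fmin_le_of_balanced:
  assumes n: "0 < n" "4 * k \<le> n" "2 ^ k \<le> n" "n \<le> 2 ^ k * q" "0 < q"
    and S: "S \<subseteq> grid d (2 ^ k * int q)" "card S = n ^ d"
    and bal: "balanced d n k (leaf_of q) S"
  shows "Fmin d n S \<le> real d * (2 * real d + 6) * (real n / 2 ^ k)"
proof -
  let ?Z = "PiE {..<d} (\<lambda>_. {..<n})" and ?R = "k * d * (n div k)"
  have finS: "finite S" using S(1) finite_grid finite_subset by blast
  have s_range: "1 \<le> s i" "s i \<le> 2 ^ k * int q" if "s \<in> S" "i < d" for s i
    using that S(1) unfolding grid_def by (auto simp: PiE_iff subset_iff)
  have leaf: "leaf_of q s i < 2 ^ k" if "s \<in> S" "i < d" for s i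
  proof -
    have "int (nat (s i - 1)) < int (2 ^ k * q)" using s_range[OF that] by simp
    then have "nat (s i - 1) < 2 ^ k * q" by (simp only: of_nat_less_iff)
    then show ?thesis unfolding leaf_of_def by (rule less_mult_imp_div_less)
  qed
  obtain f where f: "inj_on f ?Z" "\<And>z. z \<in> ?Z \<Longrightarrow> f z \<in> S"
    "\<And>z i. z \<in> ?Z \<Longrightarrow> i < d \<Longrightarrow> \<bar>2 ^ k * int (z i) - int n * int (leaf_of q (f z) i)\<bar> \<le> int (?R + 2 ^ k + n)"
    using ex_matching[OF finS S(2) n(1,2) leaf bal] by blast
  have cZ: "card ?Z = n ^ d" by (simp add: card_PiE)
  have fZ: "f ` ?Z = S"
    using f S(2) finS cZ by (intro card_subset_eq) (auto simp: card_image)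
  define g where "g = (\<lambda>s\<in>S. \<lambda>i\<in>{..<d}. int (inv_into ?Z f s i) + 1)"
  have g_f: "g (f z) = (\<lambda>i\<in>{..<d}. int (z i) + 1)" if "z \<in> ?Z" for z
    using that f unfolding g_def by simp
  have g1: "g \<in> S \<rightarrow>\<^sub>E grid d (int n)"
  proof
    fix s assume "s \<in> S"
    then obtain z where "z \<in> ?Z" "s = f z" using fZ by blast
    then show "g s \<in> grid d (int n)" unfolding grid_def by (force simp: g_f PiE_iff)
  qed (auto simp: g_def)
  have g2: "g ` S = grid d (int n)"
  proof
    show "g ` S \<subseteq> grid d (int n)" using g1 by auto
    show "grid d (int n) \<subseteq> g ` S"
    proof
      fix y assume y: "y \<in> grid d (int n)"
      define z where "z = (\<lambda>i\<in>{..<d}. nat (y i - 1))"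
      have y1: "1 \<le> y i" "y i \<le> int n" if "i < d" for i using y that unfolding grid_def by (auto simp: PiE_iff)
      have "nat (y i - 1) < n" if "i < d" for i using y1[OF that] by linarith
      then have z: "z \<in> ?Z" unfolding z_def by auto
      have "int (nat (y i - 1)) + 1 = y i" if "i < d" for i using y1[OF that] by simp
      then have "g (f z) = y" unfolding g_f[OF z]
        using y unfolding z_def grid_def by (auto simp: fun_eq_iff PiE_iff extensional_def)
      then show "y \<in> g ` S" using f(2)[OF z] by blast
    qed
  qed
  have R: "?R \<le> d * n"
  proof -
    have "?R = d * (k * (n div k))" by simp
    also have "\<dots> \<le> d * n" by (intro mult_le_mono2) simp
    finally show ?thesis .
  qed
  have "lip d S g \<le> real d * ((2 * real d + 6) * (real n / 2 ^ k))"
  proof (rule lip_le)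
    fix x y assume xy: "x \<in> S" "y \<in> S" "x \<noteq> y"
    obtain z where z: "z \<in> ?Z" "x = f z" using xy(1) unfolding fZ[symmetric] by blast
    obtain w where w: "w \<in> ?Z" "y = f w" using xy(2) unfolding fZ[symmetric] by blast
    define D where "D = edist d x y"
    have D1: "1 \<le> D" unfolding D_def using xy S(1) by (intro edist_ge_1) auto
    then show "0 < edist d x y" unfolding D_def by simp
    have "\<bar>real_of_int (g x i) - real_of_int (g y i)\<bar> \<le> (2 * real d + 6) * (real n / 2 ^ k) * D" if i: "i < d" for i
    proof -
      have *: "\<bar>2 ^ k * real (z i) - real n * real (leaf_of q (f z) i)\<bar> \<le> real d * real n + 2 ^ k + real n"
        if "z \<in> ?Z" for z
      proof -
        have "real_of_int \<bar>2 ^ k * int (z i) - int n * int (leaf_of q (f z) i)\<bar> \<le> real_of_int (int (?R + 2 ^ k + n))"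
          using f(3)[OF that i] by (rule of_int_le_iff[THEN iffD2])
        moreover have "real ?R \<le> real (d * n)" using R by (rule of_nat_mono)
        ultimately show ?thesis by simp
      qed
      have Di: "\<bar>real_of_int (x i) - real_of_int (y i)\<bar> \<le> D" unfolding D_def using i by (rule abs_le_edist)
      define l where "l = \<bar>real (leaf_of q x i) - real (leaf_of q y i)\<bar>"
      have "real q * l \<le> D + real q"
        unfolding l_def using leaf_diff[of q x i y] Di s_range[OF xy(1) i] s_range[OF xy(2) i] n(5) by linarith
      then have "l \<le> D / real q + 1" using n(5) by (simp add: field_simps)
      then have "real n * l \<le> real n * (D / real q + 1)" by (rule mult_left_mono) simp
      also have "\<dots> = real n / real q * D + real n" by (simp add: field_simps)
      also have "\<dots> \<le> 2 ^ k * D + real n"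
      proof -
        have "real n \<le> 2 ^ k * real q" using n(4) by (metis of_nat_le_iff of_nat_mult of_nat_numeral of_nat_power)
        then have "real n / real q \<le> 2 ^ k" using n(5) by (simp add: field_simps)
        then show ?thesis using D1 by (intro add_right_mono mult_right_mono) auto
      qed
      finally have nl: "\<bar>real n * real (leaf_of q x i) - real n * real (leaf_of q y i)\<bar> \<le> 2 ^ k * D + real n"
        unfolding l_def by (simp add: abs_mult flip: right_diff_distrib)
      have "2 ^ k * \<bar>real (z i) - real (w i)\<bar> = \<bar>2 ^ k * real (z i) - 2 ^ k * real (w i)\<bar>"
        by (simp add: abs_mult flip: right_diff_distrib)
      also have "\<dots> \<le> (2 * real d * real n + 2 * 2 ^ k + 3 * real n) + 2 ^ k * D"
        using *[OF z(1)] *[OF w(1)] nl unfolding z(2)[symmetric] w(2)[symmetric] by linarith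
      also have "\<dots> \<le> (2 * real d * real n + 2 * 2 ^ k + 3 * real n) * D + 2 ^ k * D"
        using D1 mult_left_mono[OF D1, of "2 * real d * real n + 2 * 2 ^ k + 3 * real n"] by simp
      also have "\<dots> = (2 * real d * real n + 3 * 2 ^ k + 3 * real n) * D" by (simp add: algebra_simps)
      also have "\<dots> \<le> (2 * real d * real n + 6 * real n) * D"
      proof -
        have "2 ^ k \<le> real n" using n(3) by (metis of_nat_le_iff of_nat_numeral of_nat_power)
        then show ?thesis using D1 by (intro mult_right_mono) auto
      qed
      finally have "\<bar>real (z i) - real (w i)\<bar> \<le> (2 * real d + 6) * (real n / 2 ^ k) * D"
        by (simp add: field_simps)
      then show ?thesis unfolding z(2) w(2) g_f[OF z(1)] g_f[OF w(1)] using i by simp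
    qed
    then have "edist d (g x) (g y) \<le> real d * ((2 * real d + 6) * (real n / 2 ^ k) * D)" by (rule edist_le)
    then show "edist d (g x) (g y) \<le> real d * ((2 * real d + 6) * (real n / 2 ^ k)) * edist d x y"
      unfolding D_def by (simp add: mult.assoc)
  qed (use finS in auto)
  then show ?thesis using Fmin_le_lip[OF finS g1 g2] by (simp add: mult.assoc)
qed

subsection \<open>Concentration of the hypergeometric distribution\<close>

lemma Suc_times_choose_Suc: "Suc j * (n choose Suc j) = (n - j) * (n choose j)"
proof (cases n)
  case (Suc m)
  then show ?thesis using Suc_times_binomial[of j m] binomial_absorb_comp[of n j] by simp
qed simp

lemma choose_mult_power_le:
  assumes "b \<le> M"
  shows "(b choose j) * M ^ j \<le> (M choose j) * b ^ j"
proof (induction j)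
  case (Suc j)
  have "(b - j) * M \<le> (M - j) * b"
    using assms by (simp add: diff_mult_distrib mult.commute[of M b] diff_le_mono2)
  then have "((b - j) * M) * ((b choose j) * M ^ j) \<le> ((M - j) * b) * ((M choose j) * b ^ j)"
    using Suc.IH by (rule mult_le_mono)
  then have "((b - j) * (b choose j)) * M ^ Suc j \<le> ((M - j) * (M choose j)) * b ^ Suc j"
    by (simp add: mult_ac)
  then have "Suc j * ((b choose Suc j) * M ^ Suc j) \<le> Suc j * ((M choose Suc j) * b ^ Suc j)"
    unfolding Suc_times_choose_Suc[symmetric] by (simp only: mult.assoc)
  then show ?case by (simp only: mult_le_cancel1)
qed simp

lemma card_supersets:
  assumes "finite G" "U \<subseteq> G" "card U \<le> m"
  shows "card {S. S \<subseteq> G \<and> card S = m \<and> U \<subseteq> S} = (card G - card U) choose (m - card U)"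
proof -
  have finU: "finite U" using assms finite_subset by blast
  have "bij_betw (\<lambda>T. T \<union> U) {T. T \<subseteq> G - U \<and> card T = m - card U} {S. S \<subseteq> G \<and> card S = m \<and> U \<subseteq> S}"
  proof (rule bij_betw_byWitness[where f' = "\<lambda>S. S - U"])
    have "card (T \<union> U) = m" if "T \<subseteq> G - U" "card T = m - card U" for T
    proof -
      have "finite T" using that assms finite_subset by blast
      then show ?thesis using that assms finU by (subst card_Un_disjoint) auto
    qed
    then show "(\<lambda>T. T \<union> U) ` {T. T \<subseteq> G - U \<and> card T = m - card U} \<subseteq> {S. S \<subseteq> G \<and> card S = m \<and> U \<subseteq> S}"
      using assms by auto
    show "(\<lambda>S. S - U) ` {S. S \<subseteq> G \<and> card S = m \<and> U \<subseteq> S} \<subseteq> {T. T \<subseteq> G - U \<and> card T = m - card U}"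
      using finU by (auto simp: card_Diff_subset)
  qed auto
  then have "card {S. S \<subseteq> G \<and> card S = m \<and> U \<subseteq> S} = card {T. T \<subseteq> G - U \<and> card T = m - card U}"
    by (simp add: bij_betw_same_card)
  also have "\<dots> = (card G - card U) choose (m - card U)"
    using assms finU by (simp add: n_subsets card_Diff_subset)
  finally show ?thesis .
qed

lemma sum_choose_inter:
  assumes "finite G" "B \<subseteq> G" "j \<le> m"
  shows "(\<Sum>S | S \<subseteq> G \<and> card S = m. card (S \<inter> B) choose j) =
    (card B choose j) * ((card G - j) choose (m - j))"
proof -
  let ?F = "{S. S \<subseteq> G \<and> card S = m}" and ?U = "{U. U \<subseteq> B \<and> card U = j}"
  have finB: "finite B" using assms finite_subset by blast
  have fin: "finite ?F" "finite ?U" using assms(1) finB by auto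
  have "(\<Sum>S\<in>?F. card (S \<inter> B) choose j) = (\<Sum>S\<in>?F. card {U \<in> ?U. U \<subseteq> S})"
  proof (intro sum.cong refl)
    fix S
    have "card {U \<in> ?U. U \<subseteq> S} = card {U. U \<subseteq> S \<inter> B \<and> card U = j}" by (rule arg_cong[where f = card]) auto
    also have "\<dots> = card (S \<inter> B) choose j" using finB by (intro n_subsets) simp
    finally show "card (S \<inter> B) choose j = card {U \<in> ?U. U \<subseteq> S}" ..
  qed
  also have "\<dots> = (\<Sum>U\<in>?U. card {S \<in> ?F. U \<subseteq> S})"
    using sum.swap_restrict[OF fin, of "\<lambda>_ _. 1::nat" "\<lambda>S U. U \<subseteq> S"] by simp
  also have "\<dots> = (\<Sum>U\<in>?U. (card G - j) choose (m - j))"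
  proof (intro sum.cong refl)
    fix U assume "U \<in> ?U"
    moreover have "{S \<in> ?F. U \<subseteq> S} = {S. S \<subseteq> G \<and> card S = m \<and> U \<subseteq> S}" by auto
    ultimately show "card {S \<in> ?F. U \<subseteq> S} = (card G - j) choose (m - j)"
      using card_supersets[of G U m] assms by auto
  qed
  also have "\<dots> = (card B choose j) * ((card G - j) choose (m - j))"
    using finB by (simp add: n_subsets)
  finally show ?thesis .
qed

lemma hypergeometric_mgf_ge:
  fixes x :: real
  assumes "finite G" "B \<subseteq> G" "m \<le> card G" "0 < card G" "0 \<le> x"
  shows "(\<Sum>S | S \<subseteq> G \<and> card S = m. (1 + x) ^ card (S \<inter> B)) \<le>
    real (card G choose m) * (1 + x * (real (card B) / real (card G))) ^ m"
proof -
  let ?F = "{S. S \<subseteq> G \<and> card S = m}"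
  define M where "M = card G"
  define b where "b = card B"
  have bM: "b \<le> M" unfolding b_def M_def using assms card_mono by blast
  have M: "0 < M" "m \<le> M" using assms unfolding M_def by auto
  have "(\<Sum>S\<in>?F. (1 + x) ^ card (S \<inter> B)) = (\<Sum>S\<in>?F. \<Sum>j\<le>m. real (card (S \<inter> B) choose j) * x ^ j)"
  proof (intro sum.cong refl)
    fix S assume S: "S \<in> ?F"
    then have "card (S \<inter> B) \<le> m" using assms(1) by (metis (lifting) card_mono finite_subset inf_le1 mem_Collect_eq)
    have "(1 + x) ^ card (S \<inter> B) = (\<Sum>j\<le>card (S \<inter> B). real (card (S \<inter> B) choose j) * x ^ j)"
      using binomial_ring[of x 1 "card (S \<inter> B)"] by (simp add: add.commute)
    also have "\<dots> = (\<Sum>j\<le>m. real (card (S \<inter> B) choose j) * x ^ j)"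
      using \<open>card (S \<inter> B) \<le> m\<close> by (intro sum.mono_neutral_left) auto
    finally show "(1 + x) ^ card (S \<inter> B) = (\<Sum>j\<le>m. real (card (S \<inter> B) choose j) * x ^ j)" .
  qed
  also have "\<dots> = (\<Sum>j\<le>m. real (\<Sum>S\<in>?F. card (S \<inter> B) choose j) * x ^ j)"
    by (subst sum.swap) (simp add: sum_distrib_right)
  also have "\<dots> = (\<Sum>j\<le>m. real ((b choose j) * ((M - j) choose (m - j))) * x ^ j)"
    unfolding b_def M_def using assms by (intro sum.cong refl) (simp add: sum_choose_inter)
  also have "\<dots> \<le> (\<Sum>j\<le>m. real (M choose m) * (real (m choose j) * (x * (real b / real M)) ^ j))"
  proof (intro sum_mono)
    fix j assume "j \<in> {..m}"
    then have j: "j \<le> m" by simp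
    have "(M choose m) * (m choose j) = (M choose j) * ((M - j) choose (m - j))"
      using j M by (intro choose_mult) auto
    moreover have "((b choose j) * M ^ j) * ((M - j) choose (m - j)) \<le> ((M choose j) * b ^ j) * ((M - j) choose (m - j))"
      using choose_mult_power_le[OF bM] by (rule mult_le_mono1)
    ultimately have "((b choose j) * ((M - j) choose (m - j))) * M ^ j \<le> (M choose m) * (m choose j) * b ^ j"
      by (simp add: mult_ac)
    then have "real (((b choose j) * ((M - j) choose (m - j))) * M ^ j) \<le> real ((M choose m) * (m choose j) * b ^ j)"
      by (rule of_nat_mono)
    then have "real ((b choose j) * ((M - j) choose (m - j))) \<le> real ((M choose m) * (m choose j)) * (real b / real M) ^ j"
      using M by (simp add: field_simps power_divide)
    then have "real ((b choose j) * ((M - j) choose (m - j))) * x ^ j \<le> real ((M choose m) * (m choose j)) * (real b / real M) ^ j * x ^ j"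
      using assms by (intro mult_right_mono) auto
    then show "real ((b choose j) * ((M - j) choose (m - j))) * x ^ j \<le>
        real (M choose m) * (real (m choose j) * (x * (real b / real M)) ^ j)"
      by (simp only: of_nat_mult power_mult_distrib mult_ac)
  qed
  also have "\<dots> = real (M choose m) * (1 + x * (real b / real M)) ^ m"
    using binomial_ring[of "x * (real b / real M)" 1 m] by (simp add: add.commute sum_distrib_left)
  finally show ?thesis unfolding M_def b_def .
qed

lemma hypergeometric_mgf:
  fixes \<theta> :: real
  assumes "finite G" "B \<subseteq> G" "m \<le> card G" "0 < card G"
  defines "\<mu> \<equiv> real m * real (card B) / real (card G)"
  shows "(\<Sum>S | S \<subseteq> G \<and> card S = m. exp (\<theta> * real (card (S \<inter> B)))) \<le>
    real (card G choose m) * exp (\<mu> * (exp \<theta> - 1))"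
proof -
  let ?F = "{S. S \<subseteq> G \<and> card S = m}"
  define p where "p = real (card B) / real (card G)"
  have finB: "finite B" using assms finite_subset by blast
  have "card B \<le> card G" using assms card_mono by blast
  then have p: "0 \<le> p" "p \<le> 1" unfolding p_def by (auto simp: divide_le_eq_1)
  have "(\<Sum>S\<in>?F. exp (\<theta> * real (card (S \<inter> B)))) \<le> real (card G choose m) * (1 + (exp \<theta> - 1) * p) ^ m"
  proof (cases "0 \<le> \<theta>")
    case True
    have "exp (\<theta> * real (card (S \<inter> B))) = (1 + (exp \<theta> - 1)) ^ card (S \<inter> B)" for S
      by (simp add: exp_of_nat_mult[symmetric] mult.commute)
    then show ?thesis using hypergeometric_mgf_ge[of G B m "exp \<theta> - 1"] assms(1-4) True unfolding p_def by simp
  next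
    \<comment> \<open>Pass to the complement of \<open>B\<close> to obtain a base above \<open>1\<close>.\<close>
    case False
    define y where "y = exp (- \<theta>) - 1"
    have y: "0 \<le> y" unfolding y_def using False by simp
    have "exp (\<theta> * real (card (S \<inter> B))) = exp \<theta> ^ m * (1 + y) ^ card (S \<inter> (G - B))" if S: "S \<in> ?F" for S
    proof -
      have finS: "finite S" using S assms(1) finite_subset by auto
      have "m = card (S \<inter> B) + card (S \<inter> (G - B))"
        using S finS by (subst card_Un_disjoint[symmetric]) (auto intro!: arg_cong[where f = card])
      then have "exp \<theta> ^ m * (1 + y) ^ card (S \<inter> (G - B)) =
          exp \<theta> ^ card (S \<inter> B) * (exp \<theta> * exp (- \<theta>)) ^ card (S \<inter> (G - B))"
        unfolding y_def by (simp add: power_add power_mult_distrib)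
      also have "\<dots> = exp \<theta> ^ card (S \<inter> B)" by (simp flip: exp_add)
      finally show ?thesis by (simp add: exp_of_nat_mult[symmetric] mult.commute)
    qed
    then have "(\<Sum>S\<in>?F. exp (\<theta> * real (card (S \<inter> B)))) = exp \<theta> ^ m * (\<Sum>S\<in>?F. (1 + y) ^ card (S \<inter> (G - B)))"
      by (simp add: sum_distrib_left)
    also have "\<dots> \<le> exp \<theta> ^ m * (real (card G choose m) * (1 + y * (real (card (G - B)) / real (card G))) ^ m)"
      using assms(1-4) y by (intro mult_left_mono hypergeometric_mgf_ge) auto
    also have "real (card (G - B)) / real (card G) = 1 - p"
      using assms(2,4) finB \<open>card B \<le> card G\<close> unfolding p_def by (simp add: card_Diff_subset of_nat_diff diff_divide_distrib)
    also have "exp \<theta> ^ m * (real (card G choose m) * (1 + y * (1 - p)) ^ m) =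
        real (card G choose m) * (exp \<theta> * (1 + y * (1 - p))) ^ m"
      by (simp add: power_mult_distrib)
    also have "exp \<theta> * (1 + y * (1 - p)) = 1 + (exp \<theta> - 1) * p"
      unfolding y_def by (simp add: algebra_simps flip: exp_add)
    finally show ?thesis .
  qed
  also have "(1 + (exp \<theta> - 1) * p) ^ m \<le> exp ((exp \<theta> - 1) * p) ^ m"
  proof (intro power_mono exp_ge_add_one_self)
    have "0 \<le> (1 - p) + exp \<theta> * p" using p by (intro add_nonneg_nonneg mult_nonneg_nonneg) auto
    then show "0 \<le> 1 + (exp \<theta> - 1) * p" by (simp add: algebra_simps)
  qed
  also have "exp ((exp \<theta> - 1) * p) ^ m = exp (\<mu> * (exp \<theta> - 1))"
    unfolding \<mu>_def p_def by (simp add: exp_of_nat_mult[symmetric] mult_ac)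
  finally show ?thesis by (simp add: mult_left_mono)
qed

lemma hypergeometric_markov:
  fixes \<theta> a :: real
  assumes "finite G" "B \<subseteq> G" "m \<le> card G" "0 < card G"
  defines "\<mu> \<equiv> real m * real (card B) / real (card G)"
  shows "real (card {S. S \<subseteq> G \<and> card S = m \<and> \<theta> * real (card (S \<inter> B)) \<ge> a}) \<le>
    real (card G choose m) * exp (\<mu> * (exp \<theta> - 1) - a)"
proof -
  let ?F = "{S. S \<subseteq> G \<and> card S = m}"
  let ?D = "{S. S \<subseteq> G \<and> card S = m \<and> \<theta> * real (card (S \<inter> B)) \<ge> a}"
  have finF: "finite ?F" using assms(1) by auto
  have "real (card ?D) * exp a = (\<Sum>S\<in>?D. exp a)" by simp
  also have "\<dots> \<le> (\<Sum>S\<in>?D. exp (\<theta> * real (card (S \<inter> B))))" by (intro sum_mono) auto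
  also have "\<dots> \<le> (\<Sum>S\<in>?F. exp (\<theta> * real (card (S \<inter> B))))" using finF by (intro sum_mono2) auto
  also have "\<dots> \<le> real (card G choose m) * exp (\<mu> * (exp \<theta> - 1))"
    unfolding \<mu>_def using assms(1-4) by (rule hypergeometric_mgf)
  finally show ?thesis by (simp add: exp_diff exp_add field_simps)
qed

lemma exp_minus_le_quadratic:
  fixes t :: real
  assumes "0 \<le> t"
  shows "exp (- t) \<le> 1 - t + t\<^sup>2"
proof -
  have "1 \<le> 1 + t ^ 3" using assms by simp
  also have "\<dots> = (1 + t) * (1 - t + t\<^sup>2)" by (simp add: algebra_simps power2_eq_square power3_eq_cube)
  also have "\<dots> \<le> exp t * (1 - t + t\<^sup>2)"
  proof (rule mult_right_mono[OF exp_ge_add_one_self])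
    have "0 \<le> (t - 1/2)\<^sup>2 + 3/4" by simp
    then show "0 \<le> 1 - t + t\<^sup>2" by (simp add: power2_eq_square algebra_simps)
  qed
  finally show ?thesis by (simp add: exp_minus field_simps)
qed

lemma hypergeometric_tail:
  fixes \<epsilon> :: real
  assumes G: "finite G" "B \<subseteq> G" "m \<le> card G" "0 < card G" and \<epsilon>: "0 \<le> \<epsilon>" "\<epsilon> \<le> 1"
  defines "\<mu> \<equiv> real m * real (card B) / real (card G)"
  shows "real (card {S. S \<subseteq> G \<and> card S = m \<and> \<bar>real (card (S \<inter> B)) - \<mu>\<bar> > \<mu> * \<epsilon>}) \<le>
    2 * real (card G choose m) * exp (- (\<mu> * \<epsilon>\<^sup>2 / 4))"
proof -
  define \<theta> where "\<theta> = \<epsilon> / 2"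
  have \<theta>: "0 \<le> \<theta>" "\<theta> \<le> 1" using \<epsilon> unfolding \<theta>_def by auto
  have \<mu>: "0 \<le> \<mu>" unfolding \<mu>_def by simp
  let ?U = "{S. S \<subseteq> G \<and> card S = m \<and> \<theta> * real (card (S \<inter> B)) \<ge> \<theta> * (\<mu> * (1 + \<epsilon>))}"
  let ?L = "{S. S \<subseteq> G \<and> card S = m \<and> - \<theta> * real (card (S \<inter> B)) \<ge> - \<theta> * (\<mu> * (1 - \<epsilon>))}"
  have fin: "finite ?U" "finite ?L" using G(1) by auto
  have "{S. S \<subseteq> G \<and> card S = m \<and> \<bar>real (card (S \<inter> B)) - \<mu>\<bar> > \<mu> * \<epsilon>} \<subseteq> ?U \<union> ?L"
  proof
    fix S assume S: "S \<in> {S. S \<subseteq> G \<and> card S = m \<and> \<bar>real (card (S \<inter> B)) - \<mu>\<bar> > \<mu> * \<epsilon>}"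
    then consider "\<mu> * (1 + \<epsilon>) \<le> real (card (S \<inter> B))" | "real (card (S \<inter> B)) \<le> \<mu> * (1 - \<epsilon>)"
      by (fastforce simp: algebra_simps abs_if split: if_splits)
    then show "S \<in> ?U \<union> ?L"
      using S \<theta>(1) by cases (auto intro: mult_left_mono)
  qed
  then have "real (card {S. S \<subseteq> G \<and> card S = m \<and> \<bar>real (card (S \<inter> B)) - \<mu>\<bar> > \<mu> * \<epsilon>}) \<le> real (card (?U \<union> ?L))"
    using fin by (intro of_nat_mono card_mono finite_UnI)
  also have "\<dots> \<le> real (card ?U + card ?L)" by (intro of_nat_mono card_Un_le)
  finally have "real (card {S. S \<subseteq> G \<and> card S = m \<and> \<bar>real (card (S \<inter> B)) - \<mu>\<bar> > \<mu> * \<epsilon>}) \<le> real (card ?U + card ?L)" .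
  moreover have "real (card ?U) \<le> real (card G choose m) * exp (- (\<mu> * \<epsilon>\<^sup>2 / 4))"
  proof -
    have "\<mu> * (exp \<theta> - 1) \<le> \<mu> * (\<theta> + \<theta>\<^sup>2)" using exp_bound[OF \<theta>] \<mu> by (intro mult_left_mono) auto
    moreover have "\<mu> * (\<theta> + \<theta>\<^sup>2) - \<theta> * (\<mu> * (1 + \<epsilon>)) = - (\<mu> * \<epsilon>\<^sup>2 / 4)"
      unfolding \<theta>_def by (simp add: field_simps power2_eq_square)
    ultimately have "\<mu> * (exp \<theta> - 1) - \<theta> * (\<mu> * (1 + \<epsilon>)) \<le> - (\<mu> * \<epsilon>\<^sup>2 / 4)" by linarith
    then have "real (card G choose m) * exp (\<mu> * (exp \<theta> - 1) - \<theta> * (\<mu> * (1 + \<epsilon>))) \<le>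
        real (card G choose m) * exp (- (\<mu> * \<epsilon>\<^sup>2 / 4))" by (intro mult_left_mono) auto
    then show ?thesis using hypergeometric_markov[OF G, of "\<theta> * (\<mu> * (1 + \<epsilon>))" \<theta>] unfolding \<mu>_def by linarith
  qed
  moreover have "real (card ?L) \<le> real (card G choose m) * exp (- (\<mu> * \<epsilon>\<^sup>2 / 4))"
  proof -
    have "\<mu> * (exp (- \<theta>) - 1) \<le> \<mu> * (- \<theta> + \<theta>\<^sup>2)"
      using exp_minus_le_quadratic[OF \<theta>(1)] \<mu> by (intro mult_left_mono) auto
    moreover have "\<mu> * (- \<theta> + \<theta>\<^sup>2) - - \<theta> * (\<mu> * (1 - \<epsilon>)) = - (\<mu> * \<epsilon>\<^sup>2 / 4)"
      unfolding \<theta>_def by (simp add: field_simps power2_eq_square)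
    ultimately have "\<mu> * (exp (- \<theta>) - 1) - - \<theta> * (\<mu> * (1 - \<epsilon>)) \<le> - (\<mu> * \<epsilon>\<^sup>2 / 4)" by linarith
    then have "real (card G choose m) * exp (\<mu> * (exp (- \<theta>) - 1) - - \<theta> * (\<mu> * (1 - \<epsilon>))) \<le>
        real (card G choose m) * exp (- (\<mu> * \<epsilon>\<^sup>2 / 4))" by (intro mult_left_mono) auto
    then show ?thesis using hypergeometric_markov[OF G, of "- \<theta> * (\<mu> * (1 - \<epsilon>))" "- \<theta>"] unfolding \<mu>_def by linarith
  qed
  ultimately show ?thesis by simp
qed

lemma card_grid: "card (grid d (int m)) = m ^ d"
  unfolding grid_def by (simp add: card_PiE)

lemma card_leaf_box:
  assumes q: "0 < q" and E: "\<And>i. i < d \<Longrightarrow> E i \<le> k" and v: "\<And>i. i < d \<Longrightarrow> v i < 2 ^ k"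
  shows "card {s \<in> grid d (2 ^ k * int q). \<forall>i<d. leaf_of q s i div 2 ^ E i = v i div 2 ^ E i} = (\<Prod>i<d. q * 2 ^ E i)"
proof -
  define m where "m i = q * 2 ^ E i" for i
  define c where "c i = v i div 2 ^ E i" for i
  have m: "0 < m i" for i unfolding m_def using q by simp
  have top: "m i * Suc (c i) \<le> 2 ^ k * q" if "i < d" for i
  proof -
    have dv: "(2::nat) ^ E i dvd 2 ^ k" using E[OF that] by (rule le_imp_power_dvd)
    have "c i < 2 ^ k div 2 ^ E i" unfolding c_def
      using v[OF that] dv by (intro less_mult_imp_div_less) (simp add: dvd_div_mult_self)
    then have "m i * Suc (c i) \<le> m i * (2 ^ k div 2 ^ E i)" by (intro mult_le_mono2) simp
    also have "\<dots> = q * (2 ^ E i * (2 ^ k div 2 ^ E i))" unfolding m_def by (simp only: mult.assoc)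
    also have "\<dots> = 2 ^ k * q" using dv by (simp only: dvd_mult_div_cancel mult.commute)
    finally show ?thesis .
  qed
  have iff: "a \<in> {1..2 ^ k * int q} \<and> nat (a - 1) div q div 2 ^ E i = v i div 2 ^ E i \<longleftrightarrow>
      a \<in> {int (m i * c i) + 1..int (m i * c i) + int (m i)}" if i: "i < d" for a i
  proof -
    have "nat (a - 1) div q div 2 ^ E i = c i \<longleftrightarrow> m i * c i \<le> nat (a - 1) \<and> nat (a - 1) < m i * Suc (c i)"
    proof
      assume "nat (a - 1) div q div 2 ^ E i = c i"
      then have "nat (a - 1) div m i = c i" unfolding m_def by (simp only: div_mult2_eq)
      then have "nat (a - 1) = m i * c i + nat (a - 1) mod m i" by (metis mult_div_mod_eq)
      then show "m i * c i \<le> nat (a - 1) \<and> nat (a - 1) < m i * Suc (c i)"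
        using mod_less_divisor[OF m, of "nat (a - 1)" i] by (metis add.commute le_add1 mult_Suc_right nat_add_left_cancel_less)
    next
      assume "m i * c i \<le> nat (a - 1) \<and> nat (a - 1) < m i * Suc (c i)"
      then have "nat (a - 1) div m i = c i" by (intro div_nat_eqI) auto
      then show "nat (a - 1) div q div 2 ^ E i = c i" unfolding m_def by (simp only: div_mult2_eq)
    qed
    moreover have top': "int (m i * c i) + int (m i) \<le> 2 ^ k * int q"
    proof -
      have "int (m i * Suc (c i)) \<le> int (2 ^ k * q)" using top[OF i] by (simp only: of_nat_le_iff)
      then show ?thesis by (simp add: algebra_simps)
    qed
    moreover define A where "A = m i * c i"
    moreover have "m i * Suc (c i) = A + m i" unfolding A_def by simp
    ultimately have *: "nat (a - 1) div q div 2 ^ E i = c i \<longleftrightarrow> A \<le> nat (a - 1) \<and> nat (a - 1) < A + m i"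
      and top': "int A + int (m i) \<le> 2 ^ k * int q"
      by (simp_all add: add.commute)
    show ?thesis unfolding c_def[symmetric] A_def[symmetric] * using top' by auto
  qed
  have "s \<in> grid d (2 ^ k * int q) \<and> (\<forall>i<d. leaf_of q s i div 2 ^ E i = v i div 2 ^ E i) \<longleftrightarrow>
      s \<in> PiE {..<d} (\<lambda>i. {int (m i * c i) + 1..int (m i * c i) + int (m i)})" for s
    unfolding grid_def leaf_of_def PiE_iff Ball_def lessThan_iff using iff by blast
  then have "{s \<in> grid d (2 ^ k * int q). \<forall>i<d. leaf_of q s i div 2 ^ E i = v i div 2 ^ E i} =
      PiE {..<d} (\<lambda>i. {int (m i * c i) + 1..int (m i * c i) + int (m i)})" by blast
  then have "card {s \<in> grid d (2 ^ k * int q). \<forall>i<d. leaf_of q s i div 2 ^ E i = v i div 2 ^ E i} = (\<Prod>i<d. m i)"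
    by (simp add: card_PiE)
  then show ?thesis unfolding m_def .
qed

lemma box_count_tail:
  fixes \<epsilon> :: real
  assumes n: "0 < n" "n \<le> 2 ^ k * q" and q: "0 < q" and E: "\<And>i. i < d \<Longrightarrow> E i \<le> k" and v: "\<And>i. i < d \<Longrightarrow> v i < 2 ^ k"
    and \<epsilon>: "0 \<le> \<epsilon>" "\<epsilon> \<le> 1"
  defines "F \<equiv> {S. S \<subseteq> grid d (2 ^ k * int q) \<and> card S = n ^ d}"
  shows "real (card {S \<in> F. \<bar>real (box_count d (leaf_of q) S E v) - mean_count d n k E\<bar> > mean_count d n k E * \<epsilon>})
    \<le> 2 * real (card F) * exp (- (mean_count d n k E * \<epsilon>\<^sup>2 / 4))"
proof -
  let ?G = "grid d (2 ^ k * int q)"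
  define B where "B = {s \<in> ?G. \<forall>i<d. leaf_of q s i div 2 ^ E i = v i div 2 ^ E i}"
  have cG: "card ?G = (2 ^ k * q) ^ d" using card_grid[of d "2 ^ k * q"] by simp
  have cF: "card F = card ?G choose n ^ d" unfolding F_def by (rule n_subsets[OF finite_grid])
  have cB: "card B = (\<Prod>i<d. q * 2 ^ E i)" unfolding B_def by (rule card_leaf_box[OF q E v])
  have mean: "real (n ^ d) * real (card B) / real (card ?G) = mean_count d n k E"
    unfolding cB cG mean_count_def using q by (simp add: prod.distrib power_mult_distrib)
  have count: "box_count d (leaf_of q) S E v = card (S \<inter> B)" if "S \<subseteq> ?G" for S
    unfolding box_count_def B_def using that by (intro arg_cong[where f = card]) auto
  have "{S \<in> F. \<bar>real (box_count d (leaf_of q) S E v) - mean_count d n k E\<bar> > mean_count d n k E * \<epsilon>} =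
      {S. S \<subseteq> ?G \<and> card S = n ^ d \<and> \<bar>real (card (S \<inter> B)) - mean_count d n k E\<bar> > mean_count d n k E * \<epsilon>}"
    unfolding F_def by (auto simp: count)
  moreover have le: "n ^ d \<le> card ?G" unfolding cG using n by (intro power_mono) auto
  moreover have pos: "0 < card ?G" unfolding cG using q by simp
  moreover have "B \<subseteq> ?G" unfolding B_def by auto
  ultimately show ?thesis
    using hypergeometric_tail[OF finite_grid _ le pos \<epsilon>, of B] unfolding mean cF by simp
qed

lemma card_not_balanced:
  assumes "2 \<le> d" and n: "0 < n" "n \<le> 2 ^ k * q" and q: "0 < q"
  defines "F \<equiv> {S. S \<subseteq> grid d (2 ^ k * int q) \<and> card S = n ^ d}"
  shows "real (card {S \<in> F. \<not> balanced d n k (leaf_of q) S})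
    \<le> real (k * d * (2 ^ k) ^ d) * (2 * real (card F) * exp (- ((real n / 2 ^ k) ^ d / (64 * (real k)\<^sup>2))))"
proof -
  let ?V = "PiE {..<d} (\<lambda>_. {..<2 ^ k :: nat})"
  let ?I = "{..<k} \<times> {..<d} \<times> ?V"
  define \<epsilon> where "\<epsilon> h = 1 / (4 * real k * 2 ^ h)" for h :: nat
  define bad where "bad = (\<lambda>(h, t, v). {S \<in> F. \<bar>real (box_count d (leaf_of q) S (expo h (Suc t)) v)
    - mean_count d n k (expo h (Suc t))\<bar> > mean_count d n k (expo h (Suc t)) * \<epsilon> h})"
  have finF: "finite F" unfolding F_def using finite_grid by simp
  have finI: "finite ?I" by (auto intro!: finite_PiE)
  have "{S \<in> F. \<not> balanced d n k (leaf_of q) S} \<subseteq> \<Union>(bad ` ?I)"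
  proof
    fix S assume "S \<in> {S \<in> F. \<not> balanced d n k (leaf_of q) S}"
    then have "S \<in> F" "\<not> balanced d n k (leaf_of q) S" by simp_all
    then obtain h t v where hv: "h < k" "t < d" "\<forall>i<d. v i < 2 ^ k"
      "\<not> \<bar>real (box_count d (leaf_of q) S (expo h (Suc t)) v) - mean_count d n k (expo h (Suc t))\<bar> \<le>
        mean_count d n k (expo h (Suc t)) / (4 * real k * 2 ^ h)"
      unfolding balanced_def by blast
    have "box_count d (leaf_of q) S (expo h (Suc t)) (restrict v {..<d}) = box_count d (leaf_of q) S (expo h (Suc t)) v"
      unfolding box_count_def by (intro arg_cong[where f = card]) auto
    then have "S \<in> bad (h, t, restrict v {..<d})"
      unfolding bad_def \<epsilon>_def using \<open>S \<in> F\<close> hv(4) by (simp add: not_le)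
    moreover have "(h, t, restrict v {..<d}) \<in> ?I" using hv by auto
    ultimately show "S \<in> \<Union>(bad ` ?I)" by blast
  qed
  then have "card {S \<in> F. \<not> balanced d n k (leaf_of q) S} \<le> card (\<Union>(bad ` ?I))"
    using finI finF by (intro card_mono) (auto simp: bad_def)
  also have "\<dots> \<le> (\<Sum>x\<in>?I. card (bad x))" by (rule card_UN_le[OF finI])
  finally have "real (card {S \<in> F. \<not> balanced d n k (leaf_of q) S}) \<le> real (\<Sum>x\<in>?I. card (bad x))"
    by (rule of_nat_mono)
  also have "\<dots> = (\<Sum>x\<in>?I. real (card (bad x)))" by (rule of_nat_sum)
  also have "\<dots> \<le> (\<Sum>x\<in>?I. 2 * real (card F) * exp (- ((real n / 2 ^ k) ^ d / (64 * (real k)\<^sup>2))))"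
  proof (intro sum_mono)
    fix x assume "x \<in> ?I"
    then obtain h t v where x: "x = (h, t, v)" "h < k" "t < d" "v \<in> ?V" by auto
    let ?E = "expo h (Suc t)" and ?\<mu> = "mean_count d n k (expo h (Suc t))"
    have "1 * 1 \<le> real k * 2 ^ h" using x by (intro mult_mono) auto
    then have \<epsilon>: "0 \<le> \<epsilon> h" "\<epsilon> h \<le> 1" unfolding \<epsilon>_def by (auto simp: divide_simps)
    have "real (card (bad x)) \<le> 2 * real (card F) * exp (- (?\<mu> * (\<epsilon> h)\<^sup>2 / 4))"
      unfolding bad_def x F_def prod.case using n q x \<epsilon> by (intro box_count_tail) (auto simp: expo_def)
    also have "\<dots> \<le> 2 * real (card F) * exp (- ((real n / 2 ^ k) ^ d / (64 * (real k)\<^sup>2)))"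
    proof -
      have "(2::real) ^ (h * 2) \<le> 2 ^ (h * d)" using assms(1) by (intro power_increasing) auto
      also have "(2::real) ^ (h * d) = (\<Prod>i<d. 2 ^ h)" by (simp add: power_mult)
      also have "\<dots> \<le> (\<Prod>i<d. 2 ^ ?E i)" by (intro prod_mono) (auto simp: expo_def)
      finally have "(real n / 2 ^ k) ^ d * 2 ^ (h * 2) \<le> (real n / 2 ^ k) ^ d * (\<Prod>i<d. 2 ^ ?E i)"
        by (intro mult_left_mono) auto
      also have "\<dots> = ?\<mu>" unfolding mean_count_def by (simp add: power_divide)
      finally have "(real n / 2 ^ k) ^ d * 2 ^ (h * 2) * ((\<epsilon> h)\<^sup>2 / 4) \<le> ?\<mu> * ((\<epsilon> h)\<^sup>2 / 4)"
        by (intro mult_right_mono) auto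
      moreover have "(real n / 2 ^ k) ^ d * 2 ^ (h * 2) * ((\<epsilon> h)\<^sup>2 / 4) = (real n / 2 ^ k) ^ d / (64 * (real k)\<^sup>2)"
        unfolding \<epsilon>_def by (simp add: power_divide power_mult_distrib power_mult[symmetric])
      ultimately show ?thesis by (intro mult_left_mono) auto
    qed
    finally show "real (card (bad x)) \<le> 2 * real (card F) * exp (- ((real n / 2 ^ k) ^ d / (64 * (real k)\<^sup>2)))" .
  qed
  also have "\<dots> = real (card ?I) * (2 * real (card F) * exp (- ((real n / 2 ^ k) ^ d / (64 * (real k)\<^sup>2))))"
    by simp
  also have "card ?I = k * d * (2 ^ k) ^ d" by (simp add: card_cartesian_product card_PiE)
  finally show ?thesis .
qed

lemma fraction_not_balanced:
  assumes "2 \<le> d" and n: "0 < n" "n \<le> 2 ^ k * q" "2 ^ k \<le> n" and q: "0 < q"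
    and big: "64 * (real d + 3) * (log 2 (real n)) ^ 3 \<le> (real n / 2 ^ k) ^ d"
  defines "F \<equiv> {S. S \<subseteq> grid d (2 ^ k * int q) \<and> card S = n ^ d}"
  shows "real (card {S \<in> F. \<not> balanced d n k (leaf_of q) S}) \<le> real (card F) * (2 * real d / (real n)\<^sup>2)"
proof (cases "k = 0")
  case True
  then show ?thesis unfolding balanced_def by simp
next
  case False
  define L where "L = log 2 (real n)"
  have "real (2 ^ k) \<le> real n" using n(3) by (rule of_nat_mono)
  then have kL: "real k \<le> L" unfolding L_def using n(1) by (simp add: le_log_iff powr_realpow)
  have k1: "1 \<le> real k" using False by simp
  have "ln (real n) \<le> L"
  proof -
    have "ln (real n) * ln 2 \<le> ln (real n) * 1" using n(1) ln_2_less_1 by (intro mult_left_mono) auto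
    then show ?thesis unfolding L_def log_def by (simp add: field_simps)
  qed
  have "(real d + 3) * L \<le> (real n / 2 ^ k) ^ d / (64 * (real k)\<^sup>2)"
  proof -
    have "(real d + 3) * L * (64 * (real k)\<^sup>2) \<le> (real d + 3) * L * (64 * L\<^sup>2)"
      using kL k1 by (intro mult_left_mono power_mono) auto
    also have "\<dots> = 64 * (real d + 3) * L ^ 3" by (simp add: power2_eq_square power3_eq_cube)
    also have "\<dots> \<le> (real n / 2 ^ k) ^ d" using big unfolding L_def .
    finally show ?thesis using k1 by (simp add: pos_le_divide_eq)
  qed
  moreover have "real (d + 3) * ln (real n) \<le> (real d + 3) * L"
    using \<open>ln (real n) \<le> L\<close> by (simp only: of_nat_add of_nat_numeral) (intro mult_left_mono, auto)
  ultimately have "real (d + 3) * ln (real n) \<le> (real n / 2 ^ k) ^ d / (64 * (real k)\<^sup>2)" by (rule order_trans[rotated])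
  then have "exp (- ((real n / 2 ^ k) ^ d / (64 * (real k)\<^sup>2))) \<le> exp (- (real (d + 3) * ln (real n)))"
    by (simp only: exp_le_cancel_iff neg_le_iff_le)
  also have "\<dots> = 1 / real n ^ (d + 3)" using n(1) by (simp only: exp_minus exp_of_nat_mult exp_ln of_nat_0_less_iff inverse_eq_divide)
  finally have e: "exp (- ((real n / 2 ^ k) ^ d / (64 * (real k)\<^sup>2))) \<le> 1 / real n ^ (d + 3)" .
  have "k \<le> n" using n(3) less_exp[of k] by linarith
  then have "k * d * (2 ^ k) ^ d \<le> n * d * n ^ d"
    using n(3) by (intro mult_le_mono power_mono) auto
  then have "real (k * d * (2 ^ k) ^ d) \<le> real (n * d * n ^ d)" by (rule of_nat_mono)
  then have "real (k * d * (2 ^ k) ^ d) * (2 * real (card F) * exp (- ((real n / 2 ^ k) ^ d / (64 * (real k)\<^sup>2))))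
      \<le> real (n * d * n ^ d) * (2 * real (card F) * (1 / real n ^ (d + 3)))"
    using e by (intro mult_mono) auto
  also have "\<dots> = real (card F) * (2 * real d / (real n)\<^sup>2)"
  proof -
    have "real n ^ (d + 3) = real n * real n ^ d * (real n)\<^sup>2"
      by (simp add: power_add power2_eq_square power3_eq_cube)
    then show ?thesis using n(1) by simp
  qed
  finally show ?thesis using card_not_balanced[OF assms(1) n(1,2) q] unfolding F_def by linarith
qed

subsection \<open>Choice of the side length\<close>

definition leaf_side :: "nat \<Rightarrow> nat \<Rightarrow> real" where
  "leaf_side d n = (64 * (real d + 3) * (log 2 (real n)) ^ 3) powr (1 / real d)"

definition level :: "nat \<Rightarrow> nat \<Rightarrow> nat" where
  "level d n = nat \<lfloor>log 2 (real n / leaf_side d n)\<rfloor>"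

definition cells :: "nat \<Rightarrow> (nat \<Rightarrow> real) \<Rightarrow> nat \<Rightarrow> nat" where
  "cells d e n = nat \<lceil>e n * real n / 2 ^ level d n\<rceil>"

definition rounded :: "nat \<Rightarrow> (nat \<Rightarrow> real) \<Rightarrow> nat \<Rightarrow> real" where
  "rounded d e n = (if n = 0 then 1 else 2 ^ level d n * real (cells d e n) / real n)"

lemma power_level_le: "2 ^ level d n \<le> max 1 (real n / leaf_side d n)"
proof (cases "level d n = 0")
  case False
  let ?x = "real n / leaf_side d n"
  have l: "1 \<le> \<lfloor>log 2 ?x\<rfloor>" using False unfolding level_def by simp
  have "?x \<noteq> 0"
  proof
    assume x0: "?x = 0"
    have "log 2 ?x = 0" unfolding x0 by (simp add: log_def)
    then show False using l by simp
  qed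
  moreover have "0 \<le> ?x" unfolding leaf_side_def by simp
  ultimately have x: "0 < ?x" by linarith
  have "real (level d n) \<le> log 2 ?x" using l unfolding level_def by simp
  then have "2 powr real (level d n) \<le> ?x" using x by (simp add: le_log_iff)
  then show ?thesis by (simp add: powr_realpow)
qed simp

lemma less_power_level:
  assumes "1 \<le> real n / leaf_side d n"
  shows "real n / leaf_side d n < 2 * 2 ^ level d n"
proof -
  let ?x = "real n / leaf_side d n"
  have "0 \<le> log 2 ?x" using assms by simp
  then have "log 2 ?x < real (level d n + 1)" unfolding level_def by simp linarith
  then have "?x < 2 powr real (level d n + 1)" using assms by (simp add: log_less_iff del: of_nat_add)
  also have "\<dots> = 2 ^ (level d n + 1)" by (rule powr_realpow) simp
  finally show ?thesis by simp
qed

lemma cells_bounds: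
  assumes "1 \<le> n" "1 \<le> e n"
  shows "0 < cells d e n" "e n * real n \<le> 2 ^ level d n * real (cells d e n)"
    "2 ^ level d n * real (cells d e n) \<le> e n * real n + 2 ^ level d n"
    "n \<le> 2 ^ level d n * cells d e n"
proof -
  let ?y = "e n * real n / 2 ^ level d n"
  have y: "0 < ?y" using assms by simp
  then show "0 < cells d e n" unfolding cells_def by simp
  have c: "?y \<le> real (cells d e n)" "real (cells d e n) \<le> ?y + 1" using y unfolding cells_def by simp_all
  show le: "e n * real n \<le> 2 ^ level d n * real (cells d e n)" using c(1) by (simp add: field_simps)
  have "2 ^ level d n * real (cells d e n) \<le> 2 ^ level d n * (?y + 1)" using c(2) by (intro mult_left_mono) auto
  then show "2 ^ level d n * real (cells d e n) \<le> e n * real n + 2 ^ level d n" by (simp add: algebra_simps)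
  have "1 * real n \<le> e n * real n" using assms by (intro mult_right_mono) auto
  then have "real n \<le> real (2 ^ level d n * cells d e n)" using le by simp
  then show "n \<le> 2 ^ level d n * cells d e n" by (simp only: of_nat_le_iff)
qed

lemma rounded_times:
  assumes "1 \<le> n"
  shows "\<lfloor>rounded d e n * real n\<rfloor> = 2 ^ level d n * int (cells d e n)"
proof -
  have "rounded d e n * real n = real_of_int (2 ^ level d n * int (cells d e n))"
    using assms unfolding rounded_def by simp
  then show ?thesis by (simp only: floor_of_int)
qed

lemma log_powr_le_leaf_side:
  assumes "2 \<le> n" "1 \<le> d"
  shows "log 2 (real n) powr (1 / real d) \<le> leaf_side d n"
proof -
  have L: "1 \<le> log 2 (real n)" using assms by (simp add: le_log_iff)
  have "log 2 (real n) * 1 \<le> log 2 (real n) * (64 * (real d + 3) * (log 2 (real n))\<^sup>2)"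
  proof (rule mult_left_mono)
    have "1 * 1 \<le> (64 * (real d + 3)) * (log 2 (real n))\<^sup>2" using L by (intro mult_mono) auto
    then show "1 \<le> 64 * (real d + 3) * (log 2 (real n))\<^sup>2" by simp
  qed (use L in auto)
  then have "log 2 (real n) \<le> 64 * (real d + 3) * (log 2 (real n)) ^ 3"
    by (simp add: power2_eq_square power3_eq_cube mult_ac)
  then show ?thesis unfolding leaf_side_def using L by (intro powr_mono2) auto
qed

lemma rounded_error:
  assumes n: "2 \<le> n" and d: "1 \<le> d" and e: "1 \<le> e n"
  shows "\<bar>rounded d e n - e n\<bar> \<le> 2 ^ (d + 8) / log 2 (real n) powr (1 / real d)"
proof -
  let ?L = "log 2 (real n)"
  have L: "1 \<le> ?L" using n by (simp add: le_log_iff)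
  have n1: "1 \<le> n" using n by simp
  have pos: "0 < ?L powr (1 / real d)" using L by simp
  define N where "N = 2 ^ level d n * real (cells d e n)"
  have r: "rounded d e n = N / real n" using n unfolding rounded_def N_def by simp
  have N: "e n * real n \<le> N" "N \<le> e n * real n + 2 ^ level d n"
    unfolding N_def using cells_bounds(2,3)[of n e d] n1 e by auto
  have "e n \<le> N / real n" using N(1) n by (simp add: pos_le_divide_eq)
  moreover have "N / real n \<le> (e n * real n + 2 ^ level d n) / real n" using N(2) by (intro divide_right_mono) auto
  then have "N / real n \<le> e n + 2 ^ level d n / real n" using n by (simp add: add_divide_distrib)
  ultimately have "0 \<le> rounded d e n - e n" "rounded d e n - e n \<le> 2 ^ level d n / real n"
    unfolding r by linarith+
  then have "\<bar>rounded d e n - e n\<bar> \<le> 2 ^ level d n / real n" by simp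
  also have "\<dots> \<le> max 1 (real n / leaf_side d n) / real n"
    by (intro divide_right_mono power_level_le) auto
  also have "\<dots> \<le> 1 / ?L powr (1 / real d)"
  proof -
    have "?L powr (1 / real d) \<le> ?L powr 1" using L d by (intro powr_mono) auto
    also have "\<dots> \<le> real n"
    proof -
      have "real n < 2 ^ n" by (rule of_nat_less_two_power)
      then have "?L \<le> log 2 (2 ^ n)" using n by (intro log_mono) auto
      then show ?thesis using L by simp
    qed
    finally have "1 / real n \<le> 1 / ?L powr (1 / real d)"
      by (intro divide_left_mono mult_pos_pos) (use pos n in auto)
    moreover have "1 / leaf_side d n \<le> 1 / ?L powr (1 / real d)"
      using log_powr_le_leaf_side[OF n d] pos
      by (intro divide_left_mono mult_pos_pos less_le_trans[OF pos]) (auto simp del: powr_gt_zero)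
    ultimately show ?thesis using n by (simp add: max_def)
  qed
  also have "\<dots> \<le> 2 ^ (d + 8) / ?L powr (1 / real d)" using pos by (intro divide_right_mono one_le_power) auto
  finally show ?thesis .
qed

lemma eventually_level:
  assumes "1 \<le> d"
  shows "\<forall>\<^sub>F n in sequentially. 2 ^ level d n \<le> n \<and> 4 * level d n \<le> n \<and>
    64 * (real d + 3) * log 2 (real n) ^ 3 \<le> (real n / 2 ^ level d n) ^ d \<and>
    real n / 2 ^ level d n \<le> 2 * leaf_side d n"
proof -
  define K where "K = 64 * (real d + 3)"
  have K: "K > 0" unfolding K_def by simp
  have ev1: "\<forall>\<^sub>F n in sequentially. 4 ^ d \<le> K * log 2 (real n) ^ 3"
  proof -
    have "filterlim (\<lambda>n. K * log 2 (real n) ^ 3) at_top sequentially" using K by real_asymp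
    then show ?thesis unfolding filterlim_at_top by blast
  qed
  have ev2: "\<forall>\<^sub>F n in sequentially. K * log 2 (real n) ^ 3 \<le> real n" using K by real_asymp
  show ?thesis using ev1 ev2
  proof eventually_elim
    case (elim n)
    let ?s = "leaf_side d n" and ?k = "level d n" and ?A = "K * log 2 (real n) ^ 3"
    have s_def: "?s = ?A powr (1 / real d)" unfolding leaf_side_def K_def ..
    have "(1::real) \<le> 4 ^ d" by simp
    then have A1: "1 \<le> ?A" using elim by linarith
    have sd: "?s ^ d = ?A"
      unfolding s_def using A1 assms by (subst powr_power) auto
    have s4: "4 \<le> ?s"
    proof (rule power_le_imp_le_base)
      show "4 ^ Suc (d - 1) \<le> ?s ^ Suc (d - 1)" using elim(1) sd assms by simp
    qed (simp add: s_def)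
    have "?s \<le> ?A powr 1" unfolding s_def using A1 assms by (intro powr_mono) auto
    also have "\<dots> \<le> real n" using A1 elim by simp
    finally have x1: "1 \<le> real n / ?s" using s4 by simp
    have k1: "2 ^ ?k \<le> real n / ?s" using power_level_le[of d n] x1 by simp
    then have ks: "2 ^ ?k * ?s \<le> real n" using s4 by (simp add: field_simps)
    have "2 ^ ?k * 4 \<le> 2 ^ ?k * ?s" using s4 by (intro mult_left_mono) auto
    then have "(2::real) ^ ?k * 4 \<le> real n" using ks by linarith
    then have "real (2 ^ ?k * 4) \<le> real n" by simp
    then have k4: "2 ^ ?k * 4 \<le> n" by (simp only: of_nat_le_iff)
    then have c1: "2 ^ ?k \<le> n" by linarith
    have "?k < 2 ^ ?k" by (rule less_exp)
    then have c2: "4 * ?k \<le> n" using k4 by linarith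
    have "?s \<le> real n / 2 ^ ?k" using ks by (simp add: pos_le_divide_eq mult.commute)
    then have c3: "?A \<le> (real n / 2 ^ ?k) ^ d"
      unfolding sd[symmetric] using s4 by (intro power_mono) auto
    have "real n < 2 * 2 ^ ?k * ?s" using less_power_level[OF x1] s4 by (simp add: pos_divide_less_eq)
    then have c4: "real n / 2 ^ ?k \<le> 2 * ?s" by (simp add: pos_divide_le_eq mult_ac)
    show ?case using c1 c2 c3 c4 unfolding K_def by blast
  qed
qed

lemma leaf_side_powr_le:
  assumes "1 \<le> d" "2 \<le> n" "3 \<le> \<alpha>"
  shows "leaf_side d n * log 2 (real n) powr (- \<alpha> / real d) \<le> (64 * (real d + 3)) powr (1 / real d)"
proof -
  let ?L = "log 2 (real n)"
  have L: "1 \<le> ?L" using assms by (simp add: le_log_iff)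
  have "(?L ^ 3) powr (1 / real d) = (?L powr 3) powr (1 / real d)"
    using L by simp
  also have "\<dots> = ?L powr (3 / real d)" by (simp add: powr_powr)
  finally have "leaf_side d n * ?L powr (- \<alpha> / real d) =
      (64 * (real d + 3)) powr (1 / real d) * (?L powr (3 / real d) * ?L powr (- \<alpha> / real d))"
    unfolding leaf_side_def by (subst powr_mult) (use L in \<open>auto simp: mult.assoc\<close>)
  also have "?L powr (3 / real d) * ?L powr (- \<alpha> / real d) = ?L powr ((3 - \<alpha>) / real d)"
    by (simp add: powr_add[symmetric] diff_divide_distrib)
  also have "(64 * (real d + 3)) powr (1 / real d) * \<dots> \<le> (64 * (real d + 3)) powr (1 / real d) * ?L powr 0"
    using L assms by (intro mult_left_mono powr_mono) (auto simp: divide_nonpos_nonneg)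
  finally show ?thesis using L by simp
qed

lemma factor_rounded:
  assumes "1 \<le> n"
  shows "factor d (rounded d e) n = {S. S \<subseteq> grid d (2 ^ level d n * int (cells d e n)) \<and> card S = n ^ d}"
  unfolding factor_def rounded_times[OF assms] ..

lemma factor_rounded_nonempty:
  assumes "1 \<le> n" "1 \<le> e n"
  shows "factor d (rounded d e) n \<noteq> {}"
proof -
  have "n ^ d \<le> (2 ^ level d n * cells d e n) ^ d" using cells_bounds(4)[of n e d] assms by (intro power_mono) auto
  also have "\<dots> = card (grid d (2 ^ level d n * int (cells d e n)))"
    using card_grid[of d "2 ^ level d n * cells d e n"] by simp
  finally obtain S where "S \<subseteq> grid d (2 ^ level d n * int (cells d e n))" "card S = n ^ d"
    by (meson obtain_subset_with_card_n)
  then show ?thesis unfolding factor_rounded[OF assms(1)] by blast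
qed

theorem theorem2:
  fixes d :: nat and e :: "nat \<Rightarrow> real"
  assumes "d \<ge> 2" and "\<And>n. e n \<ge> 1"
  shows "\<exists>c :: nat \<Rightarrow> real.
     (\<forall>n. c n > 0) \<and>
     (\<forall>n\<ge>2. \<bar>c n - e n\<bar> \<le> 2 ^ (d + 8) / (log 2 (real n)) powr (1 / real d)) \<and>
     (\<forall>n\<ge>1. factor d c n \<noteq> {}) \<and>
     (\<forall>\<alpha>::real. \<alpha> > 3 \<longrightarrow>
        measure (Gspace d c)
          {\<omega> \<in> space (Gspace d c).
             limsup (\<lambda>n. ereal (Fmin d n (\<omega> n) * (log 2 (real n)) powr (- \<alpha> / real d))) < \<infinity>}
        = 1)"
proof (intro exI conjI allI impI)
  let ?c = "rounded d e"
  show "0 < ?c n" for n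
    using cells_bounds(1)[of n e d] assms(2) unfolding rounded_def by simp
  show "\<bar>?c n - e n\<bar> \<le> 2 ^ (d + 8) / (log 2 (real n)) powr (1 / real d)" if "2 \<le> n" for n
    using rounded_error[OF that] assms by simp
  show nonempty: "factor d ?c n \<noteq> {}" if "1 \<le> n" for n
    using factor_rounded_nonempty[of n e d] that assms(2) by blast
  fix \<alpha> :: real assume \<alpha>: "3 < \<alpha>"
  define M where "M = Gspace d ?c"
  define p where "p n = pmf_of_set (factor d ?c n)" for n
  define bad where "bad n = {S \<in> factor d ?c n. \<not> balanced d n (level d n) (leaf_of (cells d e n)) S}" for n
  have M: "M = PiM {1..} (\<lambda>n. measure_pmf (p n))" unfolding M_def Gspace_def p_def ..
  have finF: "finite (factor d ?c n)" for n
    unfolding factor_def using finite_grid by (auto intro: finite_subset[OF _ finite_Pow_iff[THEN iffD2]])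
  interpret M: prob_space M unfolding M by (intro prob_space_PiM measure_pmf.prob_space_axioms)
  have proj_pmf: "(\<lambda>\<omega>. \<omega> n) \<in> measurable M (measure_pmf (p n))" if "1 \<le> n" for n
    unfolding M by (rule measurable_component_singleton) (use that in simp)
  then have proj: "(\<lambda>\<omega>. \<omega> n) \<in> measurable M (count_space UNIV)" if "1 \<le> n" for n
    using that by (simp cong: measurable_cong_sets)
  obtain N where N: "\<And>n. N \<le> n \<Longrightarrow> 2 ^ level d n \<le> n \<and> 4 * level d n \<le> n \<and>
    64 * (real d + 3) * log 2 (real n) ^ 3 \<le> (real n / 2 ^ level d n) ^ d \<and>
    real n / 2 ^ level d n \<le> 2 * leaf_side d n"
    using eventually_level[of d] assms(1) unfolding eventually_sequentially by auto
  define N2 where "N2 = max N 2"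
  define A where "A n = (if N2 \<le> n then {\<omega> \<in> space M. \<omega> n \<in> bad n} else {})" for n
  have A_sets: "A n \<in> sets M" for n
  proof (cases "N2 \<le> n")
    case True
    then have "1 \<le> n" unfolding N2_def by simp
    have "(\<lambda>\<omega>. \<omega> n) -` bad n \<inter> space M \<in> sets M" by (rule measurable_sets[OF proj[OF \<open>1 \<le> n\<close>]]) simp
    moreover have "A n = (\<lambda>\<omega>. \<omega> n) -` bad n \<inter> space M" unfolding A_def using True by auto
    ultimately show ?thesis by simp
  qed (simp add: A_def)
  have A_measure: "measure M (A n) \<le> 2 * real d / (real n)\<^sup>2" for n
  proof (cases "N2 \<le> n")
    case True
    then have n: "1 \<le> n" "N \<le> n" unfolding N2_def by simp_all
    have "measure M (A n) = measure (distr M (measure_pmf (p n)) (\<lambda>\<omega>. \<omega> n)) (bad n)"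
      using proj_pmf[OF n(1)] True unfolding A_def
      by (subst measure_distr) (auto intro!: arg_cong[where f = "measure M"])
    also have "distr M (measure_pmf (p n)) (\<lambda>\<omega>. \<omega> n) = measure_pmf (p n)"
      unfolding M by (rule distr_PiM_component) (use n in \<open>auto intro: measure_pmf.prob_space_axioms\<close>)
    also have "measure (measure_pmf (p n)) (bad n) = real (card (bad n)) / real (card (factor d ?c n))"
      unfolding p_def using nonempty[OF n(1)] finF
      by (subst measure_pmf_of_set) (auto simp: bad_def Int_def intro!: arg_cong[where f = card])
    also have "\<dots> \<le> 2 * real d / (real n)\<^sup>2"
    proof -
      have "real (card (bad n)) \<le> real (card (factor d ?c n)) * (2 * real d / (real n)\<^sup>2)"
        unfolding bad_def factor_rounded[OF n(1)]
        using n N[OF n(2)] assms cells_bounds(1,4)[of n e d] by (intro fraction_not_balanced) auto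
      moreover have "0 < card (factor d ?c n)" using nonempty[OF n(1)] finF by (simp add: card_gt_0_iff)
      ultimately show ?thesis by (simp add: pos_divide_le_eq mult.commute)
    qed
    finally show ?thesis .
  qed (simp add: A_def)
  have "summable (\<lambda>n. 2 * real d * inverse (real n ^ 2))"
    by (intro summable_mult inverse_power_summable) simp
  then have A_summable: "summable (\<lambda>n. measure M (A n))"
    by (rule summable_comparison_test'[where N = 0]) (use A_measure in \<open>auto simp: divide_inverse\<close>)
  have "AE \<omega> in M. \<forall>\<^sub>F n in sequentially. \<omega> \<in> space M - A n"
    by (rule borel_cantelli_AE1[OF A_sets _ A_summable]) (simp add: M.emeasure_eq_measure)
  moreover have "AE \<omega> in M. \<forall>n\<in>{1..}. \<omega> n \<in> factor d ?c n"
  proof (rule AE_ball_countable[THEN iffD2])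
    show "\<forall>n\<in>{1..}. AE \<omega> in M. \<omega> n \<in> factor d ?c n"
    proof
      fix n :: nat assume n: "n \<in> {1..}"
      have "AE S in measure_pmf (p n). S \<in> factor d ?c n"
        unfolding p_def using nonempty[of n] finF n by (simp add: AE_measure_pmf_iff)
      then show "AE \<omega> in M. \<omega> n \<in> factor d ?c n"
        unfolding M using n by (intro AE_PiM_component) (auto intro: measure_pmf.prob_space_axioms)
    qed
  qed simp
  ultimately have "AE \<omega> in M. limsup (\<lambda>n. ereal (Fmin d n (\<omega> n) * (log 2 (real n)) powr (- \<alpha> / real d))) < \<infinity>"
  proof eventually_elim
    case (elim \<omega>)
    define C where "C = real d * (2 * real d + 6) * (2 * (64 * (real d + 3)) powr (1 / real d))"
    have "\<forall>\<^sub>F n in sequentially. N2 \<le> n" by (rule eventually_ge_at_top)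
    with elim(1) have "\<forall>\<^sub>F n in sequentially. ereal (Fmin d n (\<omega> n) * (log 2 (real n)) powr (- \<alpha> / real d)) \<le> ereal C"
    proof eventually_elim
      case (elim n)
      then have n: "1 \<le> n" "2 \<le> n" "N \<le> n" unfolding N2_def by simp_all
      let ?w = "log 2 (real n) powr (- \<alpha> / real d)"
      have S: "\<omega> n \<in> factor d ?c n" using \<open>\<forall>n\<in>{1..}. \<omega> n \<in> factor d ?c n\<close> n by simp
      then have "balanced d n (level d n) (leaf_of (cells d e n)) (\<omega> n)"
        using elim unfolding A_def bad_def by auto
      then have "Fmin d n (\<omega> n) \<le> real d * (2 * real d + 6) * (real n / 2 ^ level d n)"
        using S n N[OF n(3)] assms cells_bounds(1,4)[of n e d] unfolding factor_rounded[OF n(1)]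
        by (intro Fmin_le_of_balanced) auto
      also have "\<dots> \<le> real d * (2 * real d + 6) * (2 * leaf_side d n)"
        using N[OF n(3)] by (intro mult_left_mono) auto
      finally have "Fmin d n (\<omega> n) * ?w \<le> real d * (2 * real d + 6) * (2 * leaf_side d n) * ?w"
        by (rule mult_right_mono) simp
      also have "\<dots> = real d * (2 * real d + 6) * (2 * (leaf_side d n * ?w))" by (simp only: mult.assoc)
      also have "\<dots> \<le> C"
        unfolding C_def using leaf_side_powr_le[of d n \<alpha>] assms(1) n \<alpha> by (intro mult_left_mono) auto
      finally show ?case by simp
    qed
    then have "limsup (\<lambda>n. ereal (Fmin d n (\<omega> n) * (log 2 (real n)) powr (- \<alpha> / real d))) \<le> ereal C"
      by (rule Limsup_bounded)
    also have "\<dots> < \<infinity>" by simp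
    finally show ?case .
  qed
  moreover have "(\<lambda>\<omega>. ereal (Fmin d n (\<omega> n) * (log 2 (real n)) powr (- \<alpha> / real d))) \<in> borel_measurable M" for n
  proof (cases "1 \<le> n")
    case True
    then show ?thesis by (intro measurable_compose[OF proj[OF True]]) simp
  next
    case False
    have und: "ereal (Fmin d n (\<omega> n) * (log 2 (real n)) powr (- \<alpha> / real d)) =
        ereal (Fmin d n undefined * (log 2 (real n)) powr (- \<alpha> / real d))" if "\<omega> \<in> space M" for \<omega>
    proof -
      have "\<omega> n = undefined" using that False unfolding M by (auto simp: space_PiM PiE_iff extensional_def)
      then show ?thesis by simp
    qed
    have "(\<lambda>_. ereal (Fmin d n undefined * (log 2 (real n)) powr (- \<alpha> / real d))) \<in> borel_measurable M" by simp
    then show ?thesis by (rule measurable_cong[THEN iffD1, rotated]) (rule und[symmetric])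
  qed
  then have "(\<lambda>\<omega>. limsup (\<lambda>n. ereal (Fmin d n (\<omega> n) * (log 2 (real n)) powr (- \<alpha> / real d)))) \<in> borel_measurable M"
    by (rule borel_measurable_limsup)
  then have "{\<omega> \<in> space M. limsup (\<lambda>n. ereal (Fmin d n (\<omega> n) * (log 2 (real n)) powr (- \<alpha> / real d))) < \<infinity>} \<in> sets M"
    by measurable
  ultimately show "measure (Gspace d ?c)
      {\<omega> \<in> space (Gspace d ?c).
        limsup (\<lambda>n. ereal (Fmin d n (\<omega> n) * (log 2 (real n)) powr (- \<alpha> / real d))) < \<infinity>} = 1"
    unfolding M_def[symmetric] by (simp add: M.prob_Collect_eq_1)
qed

end
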